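(* Let $\xi_m>0$ be fixed. For $\mu\in(0,\xi_m]$, $\lambda>0$ and $T>0$, consider the equation in the unknown $\Delta\ge 0$ $$\frac{\xi_m}{\lambda}\Delta=2T\ln\frac{\cosh\!\big(\sqrt{\xi_m^2+\Delta^2}/2T\big)}{\cosh\!\big(\sqrt{\mu^2+\Delta^2}/2T\big)}\,\Delta+\mu\int_0^{\mu}\tanh\!\Big(\frac{\sqrt{\xi^2+\Delta^2}}{2T}\Big)\frac{\Delta}{\sqrt{\xi^2+\Delta^2}}\,d\xi. \qquad (\mathrm{R})$$ Then: (i) For every $\mu\in(0,\xi_m]$ and $\lambda>0$ there is a critical temperature $T_c=T_c(\mu,\lambda)>0$ such that for $0<T<T_c$ equation (R) has a unique positive solution $\Delta=\Delta(\mu,T,\lambda)$, while for $T\ge T_c$ the only nonnegative solution of (R) is $\Delta=0$. Moreover $\Delta(\mu,T,\lambda)$ (on $\{T<T_c\}$) and $T_c(\mu,\lambda)$ depend smoothly on their arguments. (ii) For $0<T<T_c$: $\partial\Delta/\partial\mu>0$, $\partial\Delta/\partial T<0$, $\partial\Delta/\partial\lambda>0$. (iii) $\Delta(\mu,T,\lambda)\to 0$ as $T\to T_c^-$. (iv) $T_c$ is the unique positive solution $T_c$ of $$\frac{\xi_m}{\lambda}=2T_c\ln\frac{\cosh(\xi_m/2T_c)}{\cosh(\mu/2T_c)}+\mu\int_0^{\mu}\frac{1}{\xi}\tanh\Big(\frac{\xi}{2T_c}\Big)\,d\xi .$$ (v) $\partial T_c/\partial\mu>0$ and $\partial T_c/\partial\lambda>0$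 for $\mu\in(0,\xi_m]$, $\lambda>0$. (vi) The zero-temperature equation $$\frac{\xi_m}{\lambda}=\sqrt{\xi_m^2+\Delta_0^2}-\sqrt{\mu^2+\Delta_0^2}+\mu\ln\frac{\mu+\sqrt{\mu^2+\Delta_0^2}}{\Delta_0}$$ has a unique positive solution $\Delta_0=\Delta_0(\mu,\lambda)$, which equals $\lim_{T\to0}\Delta(\mu,T,\lambda)$ and satisfies $\Delta_0>\Delta(\mu,T,\lambda)\ge0$ for $T>0$. $\Delta_0$ depends smoothly on $\mu\in(0,\xi_m]$, $\lambda>0$ with $\partial\Delta_0/\partial\mu>0$, $\partial\Delta_0/\partial\lambda>0$, and $$\frac{\xi_m}{2}\Big(\lambda-\frac1\lambda\Big)<\Delta_0(\mu,\lambda)<\frac{\xi_m}{\sinh(1/\lambda)},\qquad \mu\in(0,\xi_m),\ \lambda>0,$$ where the right-hand side is $\Delta_0(\xi_m,\lambda)$ and the left-hand side is the value at $\mu=0$ (the solution of the zero-temperature equation with $\mu=0$, which is positive only when $\lambda>1$). (vii) When $\mu=0$ and $T>0$, equation (R) can have a positive solution only if $\lambda>1$.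
   Context: Physical parameters: absolute temperature $T$, gap $\Delta\ge0$, Fermi truncation energy $\xi_m>0$, doping level $\mu$ subject to the low-doping condition $|\mu|\le\xi_m$ (the equations depend on $\mu$ only through $|\mu|$, so $\mu\ge0$ is assumed), pairing coupling constant $\lambda>0$. At $\mu=0$ the integral term in (R) vanishes. The zero-temperature equation is the $T\to0$ limit of (R) divided by $\Delta$. *)

theory Defs
  imports "HOL-Analysis.Analysis"
begin

definition gap_rhs :: "real \<Rightarrow> real \<Rightarrow> real \<Rightarrow> real \<Rightarrow> real" where
  "gap_rhs xm mu T D =
     2 * T * ln (cosh (sqrt (xm\<^sup>2 + D\<^sup>2) / (2 * T)) / cosh (sqrt (mu\<^sup>2 + D\<^sup>2) / (2 * T))) * D
     + mu * integral {0..mu} (\<lambda>xi. tanh (sqrt (xi\<^sup>2 + D\<^sup>2) / (2 * T)) * D / sqrt (xi\<^sup>2 + D\<^sup>2))"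

definition gap_eq :: "real \<Rightarrow> real \<Rightarrow> real \<Rightarrow> real \<Rightarrow> real \<Rightarrow> bool" where
  "gap_eq xm mu lam T D \<longleftrightarrow> xm / lam * D = gap_rhs xm mu T D"

definition Tc_eq :: "real \<Rightarrow> real \<Rightarrow> real \<Rightarrow> real \<Rightarrow> bool" where
  "Tc_eq xm mu lam Tc \<longleftrightarrow>
     xm / lam = 2 * Tc * ln (cosh (xm / (2 * Tc)) / cosh (mu / (2 * Tc)))
                + mu * integral {0..mu} (\<lambda>xi. tanh (xi / (2 * Tc)) / xi)"

definition zeroT_eq :: "real \<Rightarrow> real \<Rightarrow> real \<Rightarrow> real \<Rightarrow> bool" where
  "zeroT_eq xm mu lam D0 \<longleftrightarrow>
     xm / lam = sqrt (xm\<^sup>2 + D0\<^sup>2) - sqrt (mu\<^sup>2 + D0\<^sup>2) + mu * ln ((mu + sqrt (mu\<^sup>2 + D0\<^sup>2)) / D0)"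

text \<open>C^k regularity on a set S (relative to S): all partial derivatives up to order k
  exist (one-sided/relative to S along coordinate lines) and are continuous on S.\<close>
fun Ck_on :: "nat \<Rightarrow> 'a::euclidean_space set \<Rightarrow> ('a \<Rightarrow> real) \<Rightarrow> bool" where
  "Ck_on 0 S f = continuous_on S f"
| "Ck_on (Suc k) S f =
     (continuous_on S f \<and>
      (\<exists>Df :: 'a \<Rightarrow> 'a \<Rightarrow> real.
         (\<forall>x\<in>S. \<forall>i\<in>Basis.
            ((\<lambda>t. f (x + t *\<^sub>R i)) has_real_derivative Df i x) (at 0 within {t. x + t *\<^sub>R i \<in> S}))
         \<and> (\<forall>i\<in>Basis. Ck_on k S (Df i))))"

definition smooth_on :: "'a::euclidean_space set \<Rightarrow> ('a \<Rightarrow> real) \<Rightarrow> bool" where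
  "smooth_on S f \<longleftrightarrow> (\<forall>k. Ck_on k S f)"

end

theory Submission
  imports Defs
begin

text \<open>
  Divided by \<open>\<Delta>\<close>, equation (R) reads \<open>H \<mu> T \<Delta> = \<xi>\<^sub>m / \<lambda>\<close> with
  \<open>H \<mu> T \<Delta> = \<integral>\<^sub>0\<^bsup>\<xi>\<^sub>m\<^esup> max \<xi> \<mu> * tanh (E / 2T) / E d\<xi>\<close> and \<open>E = sqrt (\<xi>\<^sup>2 + \<Delta>\<^sup>2)\<close>.
  As \<open>tanh x\<close> increases and \<open>tanh x / x\<close> decreases for \<open>x > 0\<close>, \<open>H\<close> is strictly decreasing in \<open>T\<close> and in
  \<open>\<Delta>\<close>; moreover
  \<open>\<partial>H/\<partial>\<mu> = \<integral>\<^sub>0\<^bsup>\<mu>\<^esup> tanh (E / 2T) / E d\<xi> > 0\<close>. Hence \<open>T\<^sub>c\<close> is the root of \<open>H \<mu> T 0 = \<xi>\<^sub>m / \<lambda>\<close> in \<open>T\<close>,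
  the gap is the root of \<open>H \<mu> T \<Delta> = \<xi>\<^sub>m / \<lambda>\<close> in \<open>\<Delta>\<close> for \<open>T < T\<^sub>c\<close>, and \<open>\<Delta>\<^sub>0\<close> is the root of the limiting
  equation for \<open>T \<rightarrow> 0\<close>; smoothness and the signs of all derivatives come from the implicit function
  theorem. The boundary value \<open>\<mu> = \<xi>\<^sub>m\<close> causes no trouble because \<open>H\<close> is smooth across it and the
  implicit function theorem is applied relative to the parameter set.
\<close>

subsection \<open>Functions with k continuous Frechet derivatives relative to a set\<close>

text \<open>Over \<open>mu \<le> xi \<le> xm\<close> the integrand of \<open>H\<close> has the
  primitive \<open>ln (cosh (b * E)) / b\<close> with \<open>b = 1 / (2 * T)\<close>; this part
  stays in closed form, and only an integral over \<open>{0..mu}\<close> remains. Its moving end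
  point is removed by \<open>xi = mu * s\<close>. The obstacle is the corner \<open>xi = 0\<close>,
  \<open>D = 0\<close>, where the square root \<open>E\<close> vanishes and is not differentiable.
  For the gap, \<open>D > 0\<close> keeps away from it. The critical temperature lives exactly at
  \<open>D = 0\<close>; there the integral is rewritten as a primitive of \<open>tanh x / x\<close>
  at \<open>b * mu\<close>. The three root functions satisfy the same abstract hypotheses: an
  equation strictly decreasing in its unknown, with values of both signs. Whether a number lies
  below or above the root is then read off from the sign of the equation at that number, which
  yields continuity, limits and inequalities without a formula for the root. Solvability for
  arbitrarily weak coupling rests on logarithmic divergence: of the integral of
  \<open>tanh (b * xi) / xi\<close> as \<open>b\<close> grows, and of the integral of
  \<open>1 / E\<close> as \<open>D\<close> tends to 0. Both carry the factor \<open>mu\<close>,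
  which is why \<open>mu = 0\<close> behaves differently and forces \<open>lam > 1\<close>.\<close>

text \<open>Unlike the coordinatewise notion \<open>Ck_on\<close>, this one obeys the chain rule on arbitrary sets.\<close>

fun diffk_on :: "nat \<Rightarrow> 'a::euclidean_space set \<Rightarrow> ('a \<Rightarrow> real) \<Rightarrow> bool" where
  "diffk_on 0 S f = continuous_on S f"
| "diffk_on (Suc k) S f =
     (\<exists>Df. (\<forall>x\<in>S. (f has_derivative (\<lambda>h. \<Sum>i\<in>Basis. (h \<bullet> i) * Df i x)) (at x within S))
         \<and> (\<forall>i\<in>Basis. diffk_on k S (Df i)))"

lemma diffk_on_SucI:
  assumes "\<And>x. x \<in> S \<Longrightarrow> (f has_derivative (\<lambda>h. \<Sum>i\<in>Basis. (h \<bullet> i) * Df i x)) (at x within S)"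
    and "\<And>i. i \<in> Basis \<Longrightarrow> diffk_on k S (Df i)"
  shows "diffk_on (Suc k) S f"
  using assms by auto

lemma diffk_on_SucE:
  assumes "diffk_on (Suc k) S f"
  shows "\<exists>Df. (\<forall>x\<in>S. (f has_derivative (\<lambda>h. \<Sum>i\<in>Basis. (h \<bullet> i) * Df i x)) (at x within S))
         \<and> (\<forall>i\<in>Basis. diffk_on k S (Df i))"
  using assms by (simp only: diffk_on.simps)

lemma diffk_on_imp_continuous_on: "diffk_on k S f \<Longrightarrow> continuous_on S f"
  by (cases k) (auto intro: has_derivative_continuous_on)

lemma diffk_on_SucD: "diffk_on (Suc k) S f \<Longrightarrow> diffk_on k S f"
proof (induction k arbitrary: f)
  case 0
  then show ?case by (simp add: diffk_on_imp_continuous_on del: diffk_on.simps(2))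
next
  case (Suc k)
  obtain Df where Df [rule_format]:
    "\<forall>x\<in>S. (f has_derivative (\<lambda>h. \<Sum>i\<in>Basis. (h \<bullet> i) * Df i x)) (at x within S)"
    "\<forall>i\<in>Basis. diffk_on (Suc k) S (Df i)"
    using diffk_on_SucE[OF Suc.prems] by blast
  show ?case by (rule diffk_on_SucI[OF Df(1) Suc.IH[OF Df(2)]])
qed

lemma diffk_on_cong:
  assumes "diffk_on k S f" "\<And>x. x \<in> S \<Longrightarrow> g x = f x"
  shows "diffk_on k S g"
proof (cases k)
  case 0
  with assms show ?thesis using continuous_on_cong[of S S g f] by auto
next
  case (Suc n)
  obtain Df where Df [rule_format]:
    "\<forall>x\<in>S. (f has_derivative (\<lambda>h. \<Sum>i\<in>Basis. (h \<bullet> i) * Df i x)) (at x within S)"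
    "\<forall>i\<in>Basis. diffk_on n S (Df i)"
    using diffk_on_SucE[OF assms(1)[unfolded Suc]] by blast
  then show ?thesis unfolding Suc
    by (intro diffk_on_SucI[where Df=Df]) (auto intro: has_derivative_transform assms(2))
qed

section \<open>Closure under arithmetic and elementary functions\<close>

lemma diffk_on_const [simp, intro]: "diffk_on k S (\<lambda>x. c)"
proof (induction k arbitrary: c)
  case (Suc k)
  show ?case by (rule diffk_on_SucI[where Df="\<lambda>_ _. 0"]) (auto simp: Suc)
qed auto

lemma diffk_on_linear:
  assumes "bounded_linear f" shows "diffk_on k S f"
proof (cases k)
  case 0
  then show ?thesis using assms by (simp add: linear_continuous_on)
next
  case (Suc n)
  have "(\<Sum>i\<in>Basis. (h \<bullet> i) * f i) = f h" for h
    using euclidean_representation[of h] linear_sum[OF bounded_linear.linear[OF assms], of "\<lambda>i. (h \<bullet> i) *\<^sub>R i" Basis]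
    by (simp add: linear_cmul[OF bounded_linear.linear[OF assms]])
  then have "(\<lambda>h. \<Sum>i\<in>Basis. (h \<bullet> i) * f i) = f" by auto
  then show ?thesis unfolding Suc
    by (intro diffk_on_SucI[where Df="\<lambda>i x. f i"])
       (auto intro: bounded_linear_imp_has_derivative assms)
qed

lemma diffk_on_add:
  "diffk_on k S f \<Longrightarrow> diffk_on k S g \<Longrightarrow> diffk_on k S (\<lambda>x. f x + g x)"
proof (induction k arbitrary: f g)
  case 0
  then show ?case by (simp add: continuous_on_add)
next
  case (Suc k)
  obtain Df where Df [rule_format]:
    "\<forall>x\<in>S. (f has_derivative (\<lambda>h. \<Sum>i\<in>Basis. (h \<bullet> i) * Df i x)) (at x within S)"
    "\<forall>i\<in>Basis. diffk_on k S (Df i)"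
    using diffk_on_SucE[OF Suc.prems(1)] by blast
  obtain Dg where Dg [rule_format]:
    "\<forall>x\<in>S. (g has_derivative (\<lambda>h. \<Sum>i\<in>Basis. (h \<bullet> i) * Dg i x)) (at x within S)"
    "\<forall>i\<in>Basis. diffk_on k S (Dg i)"
    using diffk_on_SucE[OF Suc.prems(2)] by blast
  show ?case
  proof (rule diffk_on_SucI)
    fix x assume "x \<in> S"
    from has_derivative_add[OF Df(1)[OF this] Dg(1)[OF this]]
    show "((\<lambda>x. f x + g x) has_derivative (\<lambda>h. \<Sum>i\<in>Basis. (h \<bullet> i) * (\<lambda>i x. Df i x + Dg i x) i x)) (at x within S)"
      by (simp add: sum.distrib algebra_simps)
  qed (use Suc.IH Df Dg in blast)
qed

lemma diffk_on_mult:
  "diffk_on k S f \<Longrightarrow> diffk_on k S g \<Longrightarrow> diffk_on k S (\<lambda>x. f x * g x)"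
proof (induction k arbitrary: f g)
  case 0
  then show ?case by (simp add: continuous_on_mult)
next
  case (Suc k)
  obtain Df where Df [rule_format]:
    "\<forall>x\<in>S. (f has_derivative (\<lambda>h. \<Sum>i\<in>Basis. (h \<bullet> i) * Df i x)) (at x within S)"
    "\<forall>i\<in>Basis. diffk_on k S (Df i)"
    using diffk_on_SucE[OF Suc.prems(1)] by blast
  obtain Dg where Dg [rule_format]:
    "\<forall>x\<in>S. (g has_derivative (\<lambda>h. \<Sum>i\<in>Basis. (h \<bullet> i) * Dg i x)) (at x within S)"
    "\<forall>i\<in>Basis. diffk_on k S (Dg i)"
    using diffk_on_SucE[OF Suc.prems(2)] by blast
  show ?case
  proof (rule diffk_on_SucI)
    fix x assume "x \<in> S"
    from has_derivative_mult[OF Df(1)[OF this] Dg(1)[OF this]]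
    show "((\<lambda>x. f x * g x) has_derivative
        (\<lambda>h. \<Sum>i\<in>Basis. (h \<bullet> i) * (\<lambda>i x. f x * Dg i x + Df i x * g x) i x)) (at x within S)"
      by (simp add: sum.distrib sum_distrib_left sum_distrib_right algebra_simps)
  next
    fix i :: 'a assume i: "i \<in> Basis"
    show "diffk_on k S (\<lambda>x. f x * Dg i x + Df i x * g x)"
      using Suc.prems[THEN diffk_on_SucD] Df(2)[OF i] Dg(2)[OF i]
      by (intro diffk_on_add Suc.IH)
  qed
qed

lemma diffk_on_minus: "diffk_on k S f \<Longrightarrow> diffk_on k S (\<lambda>x. - f x)"
  using diffk_on_mult[of k S "\<lambda>x. -1" f] by simp

lemma diffk_on_diff:
  "diffk_on k S f \<Longrightarrow> diffk_on k S g \<Longrightarrow> diffk_on k S (\<lambda>x. f x - g x)"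
  using diffk_on_add[of k S f "\<lambda>x. - g x"] by (simp add: diffk_on_minus)

lemma diffk_on_power: "diffk_on k S f \<Longrightarrow> diffk_on k S (\<lambda>x. f x ^ n)"
  by (induction n) (auto intro: diffk_on_mult)

lemma diffk_on_sum:
  "(\<And>i. i \<in> I \<Longrightarrow> diffk_on k S (f i)) \<Longrightarrow> diffk_on k S (\<lambda>x. \<Sum>i\<in>I. f i x)"
  by (induction I rule: infinite_finite_induct) (auto intro: diffk_on_add)

text \<open>The hypothesis concerns \<open>g'\<close> composed with \<open>f\<close>, not the
  regularity of \<open>g\<close> itself. This suits functions whose derivative is expressed through
  themselves, such as \<open>inverse\<close>, \<open>sqrt\<close> and \<open>tanh\<close>: the
  induction hypothesis for \<open>g\<close> composed with \<open>f\<close> then supplies the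
  regularity of \<open>g'\<close> composed with \<open>f\<close>.\<close>

lemma diffk_on_chain_real:
  assumes f: "diffk_on (Suc k) S f"
    and d: "\<And>x. x \<in> S \<Longrightarrow> (g has_real_derivative g' (f x)) (at (f x))"
    and g': "diffk_on k S (\<lambda>x. g' (f x))"
  shows "diffk_on (Suc k) S (\<lambda>x. g (f x))"
proof -
  obtain Df where Df [rule_format]:
    "\<forall>x\<in>S. (f has_derivative (\<lambda>h. \<Sum>i\<in>Basis. (h \<bullet> i) * Df i x)) (at x within S)"
    "\<forall>i\<in>Basis. diffk_on k S (Df i)"
    using diffk_on_SucE[OF f] by blast
  show ?thesis
  proof (rule diffk_on_SucI)
    fix x assume x: "x \<in> S"
    from has_derivative_compose[OF Df(1)[OF x] d[OF x, unfolded has_field_derivative_def]]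
    show "((\<lambda>x. g (f x)) has_derivative
        (\<lambda>h. \<Sum>i\<in>Basis. (h \<bullet> i) * (\<lambda>i x. g' (f x) * Df i x) i x)) (at x within S)"
      by (simp add: sum_distrib_left algebra_simps)
  qed (use g' Df(2) in \<open>auto intro: diffk_on_mult\<close>)
qed

lemma diffk_on_inverse:
  assumes "diffk_on k S f" "\<And>x. x \<in> S \<Longrightarrow> f x \<noteq> 0"
  shows "diffk_on k S (\<lambda>x. inverse (f x))"
  using assms(1)
proof (induction k)
  case 0
  then show ?case using assms(2) by (auto intro: continuous_on_inverse)
next
  case (Suc k)
  have "diffk_on k S (\<lambda>x. inverse (f x))"
    by (rule Suc.IH[OF diffk_on_SucD[OF Suc.prems]])
  then have "diffk_on k S (\<lambda>x. - (inverse (f x) * inverse (f x)))"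
    by (intro diffk_on_minus diffk_on_mult)
  moreover have "(inverse has_real_derivative - (inverse (f x) * inverse (f x))) (at (f x))" if "x \<in> S" for x
    using DERIV_inverse[of "f x" UNIV] assms(2)[OF that] by (simp add: power2_eq_square)
  ultimately show ?case
    by (intro diffk_on_chain_real[where g'="\<lambda>y. - (inverse y * inverse y)", OF Suc.prems])
qed

lemma diffk_on_divide:
  "diffk_on k S f \<Longrightarrow> diffk_on k S g \<Longrightarrow> (\<And>x. x \<in> S \<Longrightarrow> g x \<noteq> 0) \<Longrightarrow> diffk_on k S (\<lambda>x. f x / g x)"
  unfolding divide_inverse by (intro diffk_on_mult diffk_on_inverse)

lemma diffk_on_sqrt:
  assumes "diffk_on k S f" "\<And>x. x \<in> S \<Longrightarrow> f x > 0"
  shows "diffk_on k S (\<lambda>x. sqrt (f x))"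
  using assms(1)
proof (induction k)
  case 0
  then show ?case by (simp add: continuous_on_real_sqrt)
next
  case (Suc k)
  have s: "diffk_on k S (\<lambda>x. sqrt (f x))"
    by (rule Suc.IH[OF diffk_on_SucD[OF Suc.prems]])
  show ?case
  proof (rule diffk_on_chain_real[where g'="\<lambda>y. inverse (sqrt y) / 2", OF Suc.prems])
    show "diffk_on k S (\<lambda>x. inverse (sqrt (f x)) / 2)"
      by (intro diffk_on_divide diffk_on_inverse s diffk_on_const) (auto dest: assms(2))
  qed (rule DERIV_real_sqrt[OF assms(2)])
qed

lemma diffk_on_ln:
  assumes "diffk_on k S f" "\<And>x. x \<in> S \<Longrightarrow> f x > 0"
  shows "diffk_on k S (\<lambda>x. ln (f x))"
proof (cases k)
  case 0
  then show ?thesis using assms less_imp_neq[OF assms(2)] by (simp add: continuous_on_ln)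
next
  case (Suc n)
  show ?thesis unfolding Suc
  proof (rule diffk_on_chain_real[where g=ln and f=f and g'=inverse])
    show "diffk_on n S (\<lambda>x. inverse (f x))"
      by (rule diffk_on_inverse[OF diffk_on_SucD[OF assms(1)[unfolded Suc]]]) (auto dest: assms(2))
    show "diffk_on (Suc n) S f" using assms(1) unfolding Suc .
  qed (rule DERIV_ln[OF assms(2)])
qed

lemma DERIV_tanh_real: "(tanh has_real_derivative 1 - (tanh x)\<^sup>2) (at (x::real))"
  by (auto intro!: derivative_eq_intros)

lemma DERIV_ln_cosh: "((\<lambda>x. ln (cosh x)) has_real_derivative tanh x) (at (x::real))"
  by (auto intro!: derivative_eq_intros simp: tanh_def)

lemma diffk_on_tanh:
  assumes "diffk_on k S f"
  shows "diffk_on k S (\<lambda>x. tanh (f x))"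
  using assms
proof (induction k)
  case 0
  then show ?case by (simp add: continuous_on_tanh)
next
  case (Suc k)
  have s: "diffk_on k S (\<lambda>x. tanh (f x))"
    by (rule Suc.IH[OF diffk_on_SucD[OF Suc.prems]])
  show ?case
    by (rule diffk_on_chain_real[where g'="\<lambda>y. 1 - (tanh y)\<^sup>2", OF Suc.prems])
       (auto intro!: diffk_on_diff diffk_on_power s DERIV_tanh_real)
qed

lemma diffk_on_ln_cosh:
  assumes "diffk_on k S f"
  shows "diffk_on k S (\<lambda>x. ln (cosh (f x)))"
proof (cases k)
  case 0
  then show ?thesis using assms
    by (simp add: continuous_on_ln continuous_on_cosh)
next
  case (Suc n)
  have f: "diffk_on (Suc n) S f" using assms Suc by simp
  show ?thesis unfolding Suc
    by (rule diffk_on_chain_real[where g="\<lambda>x. ln (cosh x)" and f=f and g'=tanh, OF f])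
       (use DERIV_ln_cosh diffk_on_tanh[OF diffk_on_SucD[OF f]] in auto)
qed

text \<open>A derivative relative to \<open>T\<close> restricts to the image of \<open>S\<close>, so
  neither set has to be open. The new partial derivatives are sums of products
  \<open>Df i (g x) * Dg i j x\<close>, whose first factors are again compositions of one order
  less.\<close>

lemma diffk_on_compose:
  fixes g :: "'a::euclidean_space \<Rightarrow> 'b::euclidean_space"
  assumes "diffk_on k T f" "\<And>i. i \<in> Basis \<Longrightarrow> diffk_on k S (\<lambda>x. g x \<bullet> i)"
    and gST: "g ` S \<subseteq> T"
  shows "diffk_on k S (\<lambda>x. f (g x))"
  using assms(1,2)
proof (induction k arbitrary: f)
  case 0
  then have "continuous_on S g" by (subst continuous_on_componentwise) simp
  then show ?case using 0 gST continuous_on_compose2 by auto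
next
  case (Suc k)
  obtain Df where Df [rule_format]:
    "\<forall>x\<in>T. (f has_derivative (\<lambda>h. \<Sum>i\<in>Basis. (h \<bullet> i) * Df i x)) (at x within T)"
    "\<forall>i\<in>Basis. diffk_on k T (Df i)"
    using diffk_on_SucE[OF Suc.prems(1)] by blast
  have "\<forall>i\<in>Basis. \<exists>Dg. (\<forall>x\<in>S. ((\<lambda>x. g x \<bullet> i) has_derivative (\<lambda>h. \<Sum>j\<in>Basis. (h \<bullet> j) * Dg j x)) (at x within S))
         \<and> (\<forall>j\<in>Basis. diffk_on k S (Dg j))"
    using diffk_on_SucE[OF Suc.prems(2)] by blast
  from bchoice[OF this] obtain Dg where Dg [rule_format]:
    "\<forall>i\<in>Basis. \<forall>x\<in>S. ((\<lambda>x. g x \<bullet> i) has_derivative (\<lambda>h. \<Sum>j\<in>Basis. (h \<bullet> j) * Dg i j x)) (at x within S)"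
    "\<forall>i\<in>Basis. \<forall>j\<in>Basis. diffk_on k S (Dg i j)"
    by blast
  have gk: "\<And>i. i \<in> Basis \<Longrightarrow> diffk_on k S (\<lambda>x. g x \<bullet> i)"
    by (rule diffk_on_SucD[OF Suc.prems(2)])
  show ?case
  proof (rule diffk_on_SucI)
    fix x assume x: "x \<in> S"
    let ?g' = "\<lambda>h. \<Sum>i\<in>Basis. (\<Sum>j\<in>Basis. (h \<bullet> j) * Dg i j x) *\<^sub>R i"
    have g': "(g has_derivative ?g') (at x within S)"
      by (subst has_derivative_componentwise_within)
         (use Dg(1)[OF _ x] in \<open>simp add: inner_sum_left inner_Basis if_distrib cong: if_cong\<close>)
    have f': "(f has_derivative (\<lambda>h. \<Sum>i\<in>Basis. (h \<bullet> i) * Df i (g x))) (at (g x) within g ` S)"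
      using has_derivative_subset[OF Df(1) gST] x gST by blast
    have "(\<Sum>i\<in>Basis. (?g' h \<bullet> i) * Df i (g x))
        = (\<Sum>j\<in>Basis. (h \<bullet> j) * (\<Sum>i\<in>Basis. Df i (g x) * Dg i j x))" for h
    proof -
      have "(\<Sum>i\<in>Basis. (?g' h \<bullet> i) * Df i (g x))
        = (\<Sum>i\<in>Basis. (\<Sum>j\<in>Basis. (h \<bullet> j) * Dg i j x) * Df i (g x))"
        by (simp add: inner_sum_left inner_Basis if_distrib cong: if_cong)
      also have "\<dots> = (\<Sum>j\<in>Basis. \<Sum>i\<in>Basis. (h \<bullet> j) * Dg i j x * Df i (g x))"
        unfolding sum_distrib_right by (rule sum.swap)
      finally show ?thesis by (simp add: sum_distrib_left algebra_simps)
    qed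
    with has_derivative_in_compose[OF g' f']
    show "((\<lambda>x. f (g x)) has_derivative
        (\<lambda>h. \<Sum>j\<in>Basis. (h \<bullet> j) * (\<lambda>j x. \<Sum>i\<in>Basis. Df i (g x) * Dg i j x) j x)) (at x within S)"
      by simp
  next
    fix j :: 'a assume j: "j \<in> Basis"
    show "diffk_on k S (\<lambda>x. \<Sum>i\<in>Basis. Df i (g x) * Dg i j x)"
    proof (intro diffk_on_sum diffk_on_mult)
      fix i :: 'b assume i: "i \<in> Basis"
      show "diffk_on k S (\<lambda>x. Df i (g x))" by (rule Suc.IH[OF Df(2)[OF i] gk])
      show "diffk_on k S (Dg i j)" by (rule Dg(2)[OF i j])
    qed
  qed
qed

lemma diffk_on_compose_real:
  fixes f :: "real \<Rightarrow> real"
  assumes "diffk_on k T f" "diffk_on k S u" "\<And>x. x \<in> S \<Longrightarrow> u x \<in> T"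
  shows "diffk_on k S (\<lambda>x. f (u x))"
  by (rule diffk_on_compose[OF assms(1)]) (use assms(2,3) in auto)

lemma diffk_on_compose_Pair:
  fixes u :: "'c::euclidean_space \<Rightarrow> 'a::euclidean_space" and v :: "'c \<Rightarrow> real"
  assumes "diffk_on k T f" "\<And>i. i \<in> Basis \<Longrightarrow> diffk_on k S (\<lambda>x. u x \<bullet> i)" "diffk_on k S v"
    and "\<And>x. x \<in> S \<Longrightarrow> (u x, v x) \<in> T"
  shows "diffk_on k S (\<lambda>x. f (u x, v x))"
  by (rule diffk_on_compose[OF assms(1)]) (use assms(2-) in \<open>auto simp: Basis_prod_def\<close>)

text \<open>This is the bridge to the notion used in the theorem: a derivative relative to
  \<open>S\<close> restricts to the part of each coordinate line that lies in \<open>S\<close>,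
  where only one term of the sum over the basis survives.\<close>

lemma diffk_on_imp_Ck_on: "diffk_on k S f \<Longrightarrow> Ck_on k S f"
proof (induction k arbitrary: f)
  case (Suc k)
  obtain Df where Df [rule_format]:
    "\<forall>x\<in>S. (f has_derivative (\<lambda>h. \<Sum>i\<in>Basis. (h \<bullet> i) * Df i x)) (at x within S)"
    "\<forall>i\<in>Basis. diffk_on k S (Df i)"
    using diffk_on_SucE[OF Suc.prems(1)] by blast
  have "((\<lambda>t. f (x + t *\<^sub>R i)) has_real_derivative Df i x) (at 0 within {t. x + t *\<^sub>R i \<in> S})"
    if x: "x \<in> S" and i: "i \<in> Basis" for x i
  proof -
    let ?l = "\<lambda>t. x + t *\<^sub>R i"
    have l: "(?l has_derivative (\<lambda>t. t *\<^sub>R i)) (at 0 within {t. ?l t \<in> S})"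
      by (auto intro!: derivative_eq_intros)
    have "(f has_derivative (\<lambda>h. \<Sum>j\<in>Basis. (h \<bullet> j) * Df j x)) (at (?l 0) within ?l ` {t. ?l t \<in> S})"
      using has_derivative_subset[OF Df(1)[OF x], of "?l ` {t. ?l t \<in> S}"] by auto
    note c = has_derivative_in_compose[OF l this]
    have "(\<Sum>j\<in>Basis. (t *\<^sub>R i \<bullet> j) * Df j x) = Df i x * t" for t
    proof -
      have "(\<Sum>j\<in>Basis. (t *\<^sub>R i \<bullet> j) * Df j x) = (\<Sum>j\<in>Basis. if j = i then Df j x * t else 0)"
        using i by (intro sum.cong) (auto simp: inner_Basis)
      with i show ?thesis by simp
    qed
    with c show ?thesis unfolding has_field_derivative_def by simp
  qed
  moreover have "continuous_on S f" using Suc.prems by (rule diffk_on_imp_continuous_on)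
  ultimately show ?case using Df(2) Suc.IH by (auto intro!: exI[of _ Df])
qed simp

subsection \<open>Implicit functions\<close>

text \<open>Continuity of \<open>G\<close> is assumed, so no fixed point argument is needed. With
  \<open>F' (h, s) = c * (s - L h)\<close> the expansion of \<open>F\<close> at
  \<open>(p, G p)\<close>, evaluated on the zero set, bounds \<open>\<bar>c\<bar>\<close> times the
  remainder \<open>G q - G p - L (q - p)\<close> by a small multiple of
  \<open>norm (q - p) + \<bar>G q - G p\<bar>\<close>, and the second summand is controlled by the
  remainder itself and \<open>L\<close>.\<close>

lemma implicit_has_derivative:
  fixes F :: "'a::euclidean_space \<times> real \<Rightarrow> real" and G :: "'a \<Rightarrow> real"
  assumes F: "(F has_derivative F') (at (p, G p) within W)"
    and W: "\<And>q. q \<in> S \<Longrightarrow> (q, G q) \<in> W"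
    and p: "p \<in> S" and G: "continuous_on S G"
    and zero: "\<And>q. q \<in> S \<Longrightarrow> F (q, G q) = 0"
    and nz: "F' (0, 1) \<noteq> 0"
  shows "(G has_derivative (\<lambda>h. - F' (h, 0) / F' (0, 1))) (at p within S)"
proof -
  define c where "c = F' (0, 1)"
  define L where "L = (\<lambda>h. - F' (h, 0) / c)"
  have bl: "bounded_linear F'" using F by (rule has_derivative_bounded_linear)
  have "bounded_linear (\<lambda>h. F' (h, 0))"
    by (rule bounded_linear_compose[OF bl]) (intro bounded_linear_Pair bounded_linear_ident bounded_linear_zero)
  then have L: "bounded_linear L"
    unfolding L_def using bounded_linear_const_mult[of "\<lambda>h. F' (h, 0)" "- 1 / c"] by simp
  obtain B where B: "B > 0" "\<And>h. norm (L h) \<le> norm h * B"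
    using bounded_linear.pos_bounded[OF L] by blast
  have split: "F' (h, s) = c * (s - L h)" for h s
  proof -
    have "F' (h, s) = F' ((h, 0) + s *\<^sub>R (0, 1))" by simp
    also have "\<dots> = F' (h, 0) + s * F' (0, 1)"
      unfolding linear_add[OF bounded_linear.linear[OF bl]] linear_cmul[OF bounded_linear.linear[OF bl]] by simp
    finally show ?thesis using nz unfolding L_def c_def by (simp add: field_simps)
  qed
  have "\<exists>d>0. \<forall>q\<in>S. norm (q - p) < d \<longrightarrow> norm (G q - G p - L (q - p)) \<le> e * norm (q - p)"
    if e: "e > 0" for e
  proof -
    \<comment> \<open>The bound \<open>\<bar>c\<bar> / 2\<close> lets the remainder on the right be
      absorbed into half of the left side; the other bound turns what is left into
      \<open>e * norm (q - p)\<close>.\<close>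
    define \<epsilon> where "\<epsilon> = min (\<bar>c\<bar> / 2) (e * \<bar>c\<bar> / (2 * (1 + B)))"
    have c0: "\<bar>c\<bar> > 0" using nz c_def by simp
    have \<epsilon>: "\<epsilon> > 0" "\<epsilon> \<le> \<bar>c\<bar> / 2" "2 * (\<epsilon> * (1 + B)) \<le> e * \<bar>c\<bar>"
    proof -
      show "\<epsilon> > 0" unfolding \<epsilon>_def using c0 e B(1) by simp
      show "\<epsilon> \<le> \<bar>c\<bar> / 2" unfolding \<epsilon>_def by (rule min.cobounded1)
      have "\<epsilon> \<le> e * \<bar>c\<bar> / (2 * (1 + B))" unfolding \<epsilon>_def by (rule min.cobounded2)
      then show "2 * (\<epsilon> * (1 + B)) \<le> e * \<bar>c\<bar>" using B(1) by (simp add: pos_le_divide_eq mult.assoc mult.left_commute)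
    qed
    obtain d1 where d1: "d1 > 0" "\<And>y. y \<in> W \<Longrightarrow> norm (y - (p, G p)) < d1 \<Longrightarrow>
        norm (F y - F (p, G p) - F' (y - (p, G p))) \<le> \<epsilon> * norm (y - (p, G p))"
      using F \<epsilon>(1) unfolding has_derivative_within_alt by blast
    obtain d2 where d2: "d2 > 0" "\<And>q. q \<in> S \<Longrightarrow> dist q p < d2 \<Longrightarrow> dist (G q) (G p) < d1 / 2"
      using G p d1(1) unfolding continuous_on_iff by (metis half_gt_zero)
    show ?thesis
    proof (intro exI[of _ "min d2 (d1 / 2)"] conjI ballI impI)
      show "min d2 (d1 / 2) > 0" using d1 d2 by simp
      fix q assume q: "q \<in> S" and "norm (q - p) < min d2 (d1 / 2)"
      then have n: "norm (q - p) < d2" "norm (q - p) < d1 / 2" by auto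
      let ?r = "G q - G p - L (q - p)"
      have Gq: "\<bar>G q - G p\<bar> < d1 / 2" using d2(2)[OF q] n by (simp add: dist_norm)
      have le: "norm ((q, G q) - (p, G p)) \<le> norm (q - p) + \<bar>G q - G p\<bar>"
        using norm_Pair_le[of "q - p" "G q - G p"] by simp
      have "norm (F' (q - p, G q - G p)) \<le> \<epsilon> * norm ((q, G q) - (p, G p))"
        using d1(2)[OF W[OF q]] le n Gq zero[OF q] zero[OF p] by simp
      also have "\<dots> \<le> \<epsilon> * (norm (q - p) + \<bar>G q - G p\<bar>)"
        using le \<epsilon>(1) by (intro mult_left_mono) auto
      also have "\<dots> \<le> \<epsilon> * (norm (q - p) + (\<bar>?r\<bar> + norm (q - p) * B))"
        using B(2)[of "q - p"] \<epsilon>(1) by (intro mult_left_mono add_left_mono) (auto simp: real_norm_def)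
      also have "\<dots> = \<epsilon> * (1 + B) * norm (q - p) + \<epsilon> * \<bar>?r\<bar>" by (simp add: algebra_simps)
      also have "\<dots> \<le> \<epsilon> * (1 + B) * norm (q - p) + \<bar>c\<bar> / 2 * \<bar>?r\<bar>"
        using mult_right_mono[OF \<epsilon>(2), of "\<bar>?r\<bar>"] by simp
      finally have "\<bar>c\<bar> * \<bar>?r\<bar> \<le> 2 * (\<epsilon> * (1 + B)) * norm (q - p)"
        unfolding split by (simp add: abs_mult)
      also have "\<dots> \<le> e * \<bar>c\<bar> * norm (q - p)"
        using mult_right_mono[OF \<epsilon>(3), of "norm (q - p)"] by simp
      finally have "\<bar>c\<bar> * \<bar>?r\<bar> \<le> \<bar>c\<bar> * (e * norm (q - p))" by (simp add: algebra_simps)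
      then show "norm ?r \<le> e * norm (q - p)" using c0 by simp
    qed
  qed
  then have "(G has_derivative L) (at p within S)"
    unfolding has_derivative_within_alt using L by blast
  then show ?thesis unfolding L_def c_def .
qed

text \<open>Bootstrapping: the partial derivatives of \<open>G\<close> are quotients of partial
  derivatives of \<open>F\<close> at \<open>(q, G q)\<close>, so they are as regular as
  \<open>G\<close> is already known to be, and \<open>G\<close> gains one order. Openness of
  \<open>W\<close> identifies the last partial derivative of \<open>F\<close> with the nonzero
  \<open>c\<close>, so the quotient is defined.\<close>

lemma diffk_on_implicit:
  fixes F :: "'a::euclidean_space \<times> real \<Rightarrow> real" and G :: "'a \<Rightarrow> real"
  assumes F: "\<And>k. diffk_on k W F"
    and W: "\<And>q. q \<in> S \<Longrightarrow> (q, G q) \<in> W" and "open W"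
    and G: "continuous_on S G"
    and zero: "\<And>q. q \<in> S \<Longrightarrow> F (q, G q) = 0"
    and nz: "\<And>q. q \<in> S \<Longrightarrow> \<exists>c. c \<noteq> 0 \<and> ((\<lambda>y. F (q, y)) has_real_derivative c) (at (G q))"
  shows "diffk_on k S G"
proof (induction k)
  case 0
  then show ?case using G by simp
next
  case (Suc k)
  obtain DF where DF [rule_format]:
    "\<forall>x\<in>W. (F has_derivative (\<lambda>h. \<Sum>i\<in>Basis. (h \<bullet> i) * DF i x)) (at x within W)"
    "\<forall>i\<in>Basis. diffk_on k W (DF i)"
    using diffk_on_SucE[OF F] by blast
  have b: "(i, 0) \<in> Basis" "(0, 1) \<in> (Basis :: ('a \<times> real) set)" if "i \<in> Basis" for i :: 'a
    using that by (auto simp: Basis_prod_def image_iff)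
  have coord: "(\<Sum>i\<in>Basis. ((h, s) \<bullet> i) * DF i x) = (\<Sum>i\<in>Basis. (h \<bullet> i) * DF (i, 0) x) + s * DF (0, 1) x"
    for h s x
    by (simp add: Basis_prod_def sum.union_disjoint disjoint_iff sum.reindex inj_on_def image_iff)
  have DF0: "DF (0, 1) (q, G q) \<noteq> 0" if q: "q \<in> S" for q
  proof -
    obtain c where c: "c \<noteq> 0" "((\<lambda>y. F (q, y)) has_real_derivative c) (at (G q))"
      using nz[OF q] by blast
    have "(F has_derivative (\<lambda>h. \<Sum>i\<in>Basis. (h \<bullet> i) * DF i (q, G q))) (at (q, G q))"
      using DF(1)[OF W[OF q]] at_within_open[OF W[OF q] \<open>open W\<close>] by simp
    moreover have "((\<lambda>y. (q, y)) has_derivative (\<lambda>t. (0, t))) (at (G q))"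
      by (auto intro!: derivative_eq_intros)
    ultimately have "((\<lambda>y. F (q, y)) has_derivative (\<lambda>t. \<Sum>i\<in>Basis. ((0, t) \<bullet> i) * DF i (q, G q))) (at (G q))"
      using has_derivative_compose by blast
    then have "((\<lambda>y. F (q, y)) has_real_derivative DF (0, 1) (q, G q)) (at (G q))"
      unfolding coord has_field_derivative_def by (simp add: mult.commute[of _ "DF _ _"])
    with c show ?thesis using DERIV_unique by blast
  qed
  have comp: "diffk_on k S (\<lambda>q. DF i (q, G q))" if "i \<in> Basis" for i
    by (rule diffk_on_compose_Pair[OF DF(2)[OF that] diffk_on_linear Suc.IH W])
       (rule bounded_linear_inner_left)
  show ?case
  proof (rule diffk_on_SucI)
    fix q assume q: "q \<in> S"
    have "(\<lambda>h. - (\<Sum>i\<in>Basis. ((h, 0) \<bullet> i) * DF i (q, G q)) / (\<Sum>i\<in>Basis. ((0, 1) \<bullet> i) * DF i (q, G q)))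
        = (\<lambda>h. \<Sum>i\<in>Basis. (h \<bullet> i) * (- DF (i, 0) (q, G q) / DF (0, 1) (q, G q)))"
      unfolding coord by (simp add: sum_divide_distrib sum_negf[symmetric])
    moreover have "(G has_derivative (\<lambda>h. - (\<Sum>i\<in>Basis. ((h, 0) \<bullet> i) * DF i (q, G q)) /
        (\<Sum>i\<in>Basis. ((0, 1) \<bullet> i) * DF i (q, G q)))) (at q within S)"
      using implicit_has_derivative[OF DF(1)[OF W[OF q]] W q G zero] DF0[OF q]
      unfolding coord by simp
    ultimately show "(G has_derivative
       (\<lambda>h. \<Sum>i\<in>Basis. (h \<bullet> i) * (\<lambda>i q. - DF (i, 0) (q, G q) / DF (0, 1) (q, G q)) i q)) (at q within S)"
      by simp
  next
    fix i :: 'a assume "i \<in> Basis"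
    with b comp DF0 show "diffk_on k S (\<lambda>q. - DF (i, 0) (q, G q) / DF (0, 1) (q, G q))"
      by (intro diffk_on_divide diffk_on_minus) auto
  qed
qed

text \<open>\<open>S\<close> need not be open: at its boundary points derivatives of the root are taken relative to \<open>S\<close>,
  while \<open>F\<close> is smooth on a full neighbourhood.\<close>

locale decreasing_equation =
  fixes F :: "'a::euclidean_space \<times> real \<Rightarrow> real" and P S :: "'a set"
  assumes smooth: "\<And>k. diffk_on k (P \<times> {0<..}) F"
    and open_P: "open P" and S_P: "S \<subseteq> P"
    and decr: "\<And>p y. p \<in> S \<Longrightarrow> y > 0 \<Longrightarrow> \<exists>c<0. ((\<lambda>y. F (p, y)) has_real_derivative c) (at y)"
    and ex_pos: "\<And>p. p \<in> S \<Longrightarrow> \<exists>y>0. F (p, y) > 0"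
    and ex_neg: "\<And>p. p \<in> S \<Longrightarrow> \<exists>y>0. F (p, y) < 0"
begin

definition root :: "'a \<Rightarrow> real" where "root p = (THE y. y > 0 \<and> F (p, y) = 0)"

lemma strict_decr: "p \<in> S \<Longrightarrow> 0 < x \<Longrightarrow> x < y \<Longrightarrow> F (p, y) < F (p, x)"
  by (rule DERIV_neg_imp_decreasing[of x y "\<lambda>y. F (p, y)"]) (use decr less_le_trans in blast)+

lemma less_iff: "p \<in> S \<Longrightarrow> 0 < x \<Longrightarrow> 0 < y \<Longrightarrow> F (p, y) < F (p, x) \<longleftrightarrow> x < y"
  using strict_decr[of p x y] strict_decr[of p y x] by (cases x y rule: linorder_cases) auto

lemma ex1_root:
  assumes p: "p \<in> S" shows "\<exists>!y. y > 0 \<and> F (p, y) = 0"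
proof -
  obtain a where a: "a > 0" "F (p, a) > 0" using ex_pos[OF p] by blast
  obtain b where b: "b > 0" "F (p, b) < 0" using ex_neg[OF p] by blast
  \<comment> \<open>The hypotheses provide the two witnesses in no particular order; strict decrease
    places the positive value to the left.\<close>
  have "a < b" using less_iff[OF p a(1) b(1)] a b by simp
  then have "\<exists>y. a \<le> y \<and> y \<le> b \<and> F (p, y) = 0"
  proof (intro IVT2 allI impI)
    fix x assume "a \<le> x \<and> x \<le> b"
    then have "x > 0" using a(1) by simp
    then show "isCont (\<lambda>x. F (p, x)) x" using decr[OF p] DERIV_isCont by blast
  qed (use a b in auto)
  then obtain y where "y > 0" "F (p, y) = 0" using a(1) less_le_trans by blast
  moreover have "z = y" if "z > 0" "F (p, z) = 0" for z
    using strict_decr[OF p, of y z] strict_decr[OF p, of z y] that \<open>y > 0\<close> \<open>F (p, y) = 0\<close>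
    by (cases y z rule: linorder_cases) auto
  ultimately show ?thesis by blast
qed

lemma root_pos: "p \<in> S \<Longrightarrow> root p > 0" and root_zero: "p \<in> S \<Longrightarrow> F (p, root p) = 0"
  using theI'[OF ex1_root, of p] unfolding root_def by auto

lemma root_unique: "p \<in> S \<Longrightarrow> y > 0 \<Longrightarrow> F (p, y) = 0 \<Longrightarrow> y = root p"
  using ex1_root root_pos root_zero by blast

text \<open>Together with \<open>root_less_iff\<close> this turns every comparison with the root
  into a sign condition on \<open>F\<close>, the only access to the root used for continuity, limits
  and bounds below.\<close>

lemma less_root_iff: "p \<in> S \<Longrightarrow> y > 0 \<Longrightarrow> y < root p \<longleftrightarrow> F (p, y) > 0"
  using less_iff[of p y "root p"] root_pos root_zero by simp

lemma root_less_iff: "p \<in> S \<Longrightarrow> y > 0 \<Longrightarrow> root p < y \<longleftrightarrow> F (p, y) < 0"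
  using less_iff[of p "root p" y] root_pos root_zero by simp

text \<open>For fixed \<open>y > 0\<close> the condition \<open>y < root q\<close> reads
  \<open>F (q, y) > 0\<close>, which persists for nearby \<open>q\<close> by continuity of
  \<open>F\<close>; the same holds for \<open>root q < y\<close>. Levels \<open>y \<le> 0\<close>
  lie below every root.\<close>

lemma continuous_on_root: "continuous_on S root"
  unfolding continuous_on_def
proof (intro ballI order_tendstoI)
  fix p assume p: "p \<in> S"
  have c: "continuous_on (P \<times> {0<..}) F" using smooth[of 0] by simp
  have cont: "((\<lambda>q. F (q, y)) \<longlongrightarrow> F (p, y)) (at p within S)" if "y > 0" for y
  proof -
    have "continuous_on S (\<lambda>q. F (q, y))"
      using that S_P by (intro continuous_on_compose2[OF c]) (auto intro!: continuous_intros)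
    then show ?thesis using p by (simp add: continuous_on_def)
  qed
  fix y
  { assume y: "y < root p"
    show "eventually (\<lambda>q. y < root q) (at p within S)"
    proof (cases "y > 0")
      case True
      then have "eventually (\<lambda>q. F (q, y) > 0) (at p within S)"
        using order_tendstoD(1)[OF cont] less_root_iff[OF p] y by simp
      moreover have "eventually (\<lambda>q. q \<in> S) (at p within S)" by (simp add: eventually_at_filter)
      ultimately show ?thesis by eventually_elim (use True less_root_iff in auto)
    next
      case False
      have "eventually (\<lambda>q. q \<in> S) (at p within S)" by (simp add: eventually_at_filter)
      then show ?thesis by eventually_elim (use False root_pos in force)
    qed }
  { assume y: "root p < y"
    then have y0: "y > 0" using root_pos[OF p] by simp
    then have "eventually (\<lambda>q. F (q, y) < 0) (at p within S)"
      using order_tendstoD(2)[OF cont] root_less_iff[OF p] y by simp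
    moreover have "eventually (\<lambda>q. q \<in> S) (at p within S)" by (simp add: eventually_at_filter)
    ultimately show "eventually (\<lambda>q. root q < y) (at p within S)"
      by eventually_elim (use y0 root_less_iff in auto) }
qed

lemma diffk_on_root: "diffk_on k S root"
proof (rule diffk_on_implicit[OF smooth _ _ continuous_on_root root_zero])
  show "open (P \<times> {0::real<..})" using open_P by (intro open_Times) auto
  show "(q, root q) \<in> P \<times> {0<..}" if "q \<in> S" for q using that S_P root_pos by auto
  show "\<exists>c. c \<noteq> 0 \<and> ((\<lambda>y. F (q, y)) has_real_derivative c) (at (root q))" if "q \<in> S" for q
    using decr[OF that root_pos[OF that]] less_imp_neq by blast
qed

lemma smooth_on_root: "smooth_on S root"
  unfolding smooth_on_def using diffk_on_root diffk_on_imp_Ck_on by blast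

text \<open>The factor \<open>c\<close> is \<open>-1\<close> divided by the derivative of
  \<open>F\<close> in the unknown, hence positive. So the derivative of the root has the sign of
  \<open>a\<close>, the derivative of \<open>F\<close> along the curve with the root frozen. All
  monotonicity claims of the theorem come from this; the set \<open>I\<close> allows one-sided
  derivatives at \<open>mu = xm\<close>.\<close>

lemma root_DERIV_along:
  fixes \<gamma> :: "real \<Rightarrow> 'a"
  assumes p: "\<gamma> t \<in> S" and \<gamma>: "(\<gamma> has_vector_derivative v) (at t)" and I: "\<gamma> ` I \<subseteq> S"
    and a: "((\<lambda>s. F (\<gamma> s, root (\<gamma> t))) has_real_derivative a) (at t)"
  shows "\<exists>c>0. ((\<lambda>s. root (\<gamma> s)) has_real_derivative a * c) (at t within I)"
proof -
  let ?W = "P \<times> {0::real<..}"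
  have W: "(q, root q) \<in> ?W" if "q \<in> S" for q using that S_P root_pos by auto
  have oW: "open ?W" using open_P by (intro open_Times) auto
  obtain DF where "\<forall>x\<in>?W. (F has_derivative (\<lambda>h. \<Sum>i\<in>Basis. (h \<bullet> i) * DF i x)) (at x within ?W)"
    using diffk_on_SucE[OF smooth[of "Suc 0"]] by blast
  from bspec[OF this W[OF p]] obtain F' where F': "(F has_derivative F') (at (\<gamma> t, root (\<gamma> t)))"
    unfolding at_within_open[OF W[OF p] oW] by blast
  obtain c where c: "c < 0" "((\<lambda>y. F (\<gamma> t, y)) has_real_derivative c) (at (root (\<gamma> t)))"
    using decr[OF p root_pos[OF p]] by blast
  \<comment> \<open>Uniqueness of derivatives, along the unknown and along the curve, identifies the
    two values of \<open>F'\<close> that enter the implicit formula with the given \<open>c\<close>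
    and \<open>a\<close>.\<close>
  have "((\<lambda>y. (\<gamma> t, y)) has_derivative (\<lambda>s. (0, s))) (at (root (\<gamma> t)))"
    by (auto intro!: derivative_eq_intros)
  from has_derivative_unique[OF has_derivative_compose[OF this F'] c(2)[unfolded has_field_derivative_def]]
  have F'1: "F' (0, 1) = c" by (metis mult.right_neutral)
  have "((\<lambda>s. (\<gamma> s, root (\<gamma> t))) has_derivative (\<lambda>s. (s *\<^sub>R v, 0))) (at t)"
    using \<gamma> unfolding has_vector_derivative_def by (auto intro!: derivative_eq_intros)
  from has_derivative_unique[OF has_derivative_compose[OF this F'] a[unfolded has_field_derivative_def]]
  have F'2: "F' (s *\<^sub>R v, 0) = a * s" for s by metis
  have "(root has_derivative (\<lambda>h. - F' (h, 0) / F' (0, 1))) (at (\<gamma> t) within S)"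
    by (rule implicit_has_derivative[where W=UNIV and F=F])
       (use F' p continuous_on_root root_zero F'1 c(1) in auto)
  then have "(root has_derivative (\<lambda>h. - F' (h, 0) / c)) (at (\<gamma> t) within \<gamma> ` I)"
    unfolding F'1 using has_derivative_subset I by blast
  from has_derivative_in_compose[OF has_derivative_at_withinI[OF \<gamma>[unfolded has_vector_derivative_def]] this]
  have "((\<lambda>s. root (\<gamma> s)) has_derivative (\<lambda>s. - (a * s) / c)) (at t within I)"
    unfolding F'2 .
  moreover have "(\<lambda>s. - (a * s) / c) = (*) (a * (- 1 / c))" by auto
  ultimately have "((\<lambda>s. root (\<gamma> s)) has_real_derivative a * (- 1 / c)) (at t within I)"
    unfolding has_field_derivative_def by simp
  moreover have "- 1 / c > 0" using c(1) by (simp add: divide_neg_neg)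
  ultimately show ?thesis by blast
qed

end

subsection \<open>Smooth parametric integrals\<close>

text \<open>The weight \<open>w\<close> makes this family of integrals closed under differentiation:
  the derivative in \<open>fst x\<close> multiplies the weight by \<open>s\<^sup>2\<close>, the one
  in \<open>snd x\<close> keeps it, and both replace \<open>g\<close> by \<open>g'\<close>.\<close>

lemma has_derivative_param_integral:
  fixes g g' w :: "real \<Rightarrow> real"
  assumes g: "\<And>z. z > 0 \<Longrightarrow> (g has_real_derivative g' z) (at z)"
    and g': "continuous_on {0<..} g'" and w: "continuous_on {0..1} w"
    and x: "x \<in> {0<..} \<times> {0<..}"
  shows "((\<lambda>x. integral {0..1} (\<lambda>s. w s * g (fst x * s\<^sup>2 + snd x))) has_derivative
     (\<lambda>h. fst h * integral {0..1} (\<lambda>s. (w s * s\<^sup>2) * g' (fst x * s\<^sup>2 + snd x))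
        + snd h * integral {0..1} (\<lambda>s. w s * g' (fst x * s\<^sup>2 + snd x))))
     (at x within {0<..} \<times> {0<..})"
proof -
  let ?U = "{0::real<..} \<times> {0::real<..}"
  \<comment> \<open>The derivative of the integrand in \<open>x\<close>, written as a bounded linear
    functional because the Leibniz rule for several parameters integrates it as such.\<close>
  define fx :: "real \<times> real \<Rightarrow> real \<Rightarrow> (real \<times> real) \<Rightarrow>\<^sub>L real" where
    "fx y s = (w s * g' (fst y * s\<^sup>2 + snd y)) *\<^sub>R (s\<^sup>2 *\<^sub>R fst_blinfun + snd_blinfun)" for y s
  have pos: "fst y * s\<^sup>2 + snd y > 0" if "y \<in> ?U" for y s
    using that by (intro add_nonneg_pos) auto
  have gc: "continuous_on {0<..} g"
    by (intro continuous_at_imp_continuous_on ballI DERIV_isCont) (auto intro: g)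
  have w2: "continuous_on (?U \<times> cbox 0 1) (\<lambda>z. w (snd z))"
    by (rule continuous_on_compose2[OF w]) (auto intro!: continuous_intros)
  have g2: "continuous_on (?U \<times> cbox 0 1) (\<lambda>z. g' (fst (fst z) * (snd z)\<^sup>2 + snd (fst z)))"
    by (rule continuous_on_compose2[OF g']) (auto intro!: continuous_intros pos[simplified] add_nonneg_pos)
  have ig: "continuous_on {0..1} (\<lambda>s. w s * g (fst y * s\<^sup>2 + snd y))" if "y \<in> ?U" for y
    using that pos
    by (intro continuous_on_mult w continuous_on_compose2[OF gc]) (auto intro!: continuous_intros)
  have ig': "continuous_on {0..1} (\<lambda>s. w s * g' (fst y * s\<^sup>2 + snd y))" if "y \<in> ?U" for y
    using that pos
    by (intro continuous_on_mult w continuous_on_compose2[OF g']) (auto intro!: continuous_intros)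
  have "((\<lambda>x. integral (cbox 0 1) (\<lambda>s. w s * g (fst x * s\<^sup>2 + snd x))) has_derivative
      blinfun_apply (integral (cbox 0 1) (fx x))) (at x within ?U)"
  proof (rule leibniz_rule[OF _ _ _ x])
    fix y s assume y: "y \<in> ?U"
    have "((\<lambda>y. fst y * s\<^sup>2 + snd y) has_derivative (\<lambda>h. fst h * s\<^sup>2 + snd h)) (at y within ?U)"
      by (auto intro!: derivative_eq_intros)
    from has_derivative_compose[OF this g[OF pos[OF y], unfolded has_field_derivative_def]]
    have "((\<lambda>y. g (fst y * s\<^sup>2 + snd y)) has_derivative
        (\<lambda>h. g' (fst y * s\<^sup>2 + snd y) * (fst h * s\<^sup>2 + snd h))) (at y within ?U)" .
    from has_derivative_mult_right[OF this, of "w s"]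
    show "((\<lambda>y. w s * g (fst y * s\<^sup>2 + snd y)) has_derivative blinfun_apply (fx y s)) (at y within ?U)"
      by (rule has_derivative_eq_rhs) (auto simp: fx_def blinfun.bilinear_simps algebra_simps)
  next
    fix y assume "y \<in> ?U"
    then show "(\<lambda>s. w s * g (fst y * s\<^sup>2 + snd y)) integrable_on cbox 0 1"
      using ig by (auto intro!: integrable_continuous_interval simp: cbox_interval)
  next
    show "continuous_on (?U \<times> cbox 0 1) (\<lambda>(x, t). fx x t)"
      unfolding fx_def case_prod_beta by (intro continuous_intros w2 g2)
  qed (auto intro!: convex_Times)
  moreover have "blinfun_apply (integral (cbox 0 1) (fx x)) =
     (\<lambda>h. fst h * integral {0..1} (\<lambda>s. (w s * s\<^sup>2) * g' (fst x * s\<^sup>2 + snd x))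
        + snd h * integral {0..1} (\<lambda>s. w s * g' (fst x * s\<^sup>2 + snd x)))"
  proof
    fix h
    have c: "continuous_on {0..1} (\<lambda>s. w s * s\<^sup>2 * g' (fst x * s\<^sup>2 + snd x))"
      using continuous_on_mult[OF ig'[OF x], of "\<lambda>s. s\<^sup>2"] by (simp add: continuous_intros algebra_simps)
    have "continuous_on {0..1} (fx x)"
      unfolding fx_def by (intro continuous_intros ig'[OF x])
    then have "blinfun_apply (integral (cbox 0 1) (fx x)) h = integral {0..1} (\<lambda>s. blinfun_apply (fx x s) h)"
      by (simp add: blinfun_apply_integral integrable_continuous_interval cbox_interval)
    also have "\<dots> = integral {0..1} (\<lambda>s. fst h * ((w s * s\<^sup>2) * g' (fst x * s\<^sup>2 + snd x))
       + snd h * (w s * g' (fst x * s\<^sup>2 + snd x)))"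
      unfolding fx_def by (simp add: blinfun.bilinear_simps algebra_simps)
    also have "\<dots> = integral {0..1} (\<lambda>s. fst h * ((w s * s\<^sup>2) * g' (fst x * s\<^sup>2 + snd x)))
       + integral {0..1} (\<lambda>s. snd h * (w s * g' (fst x * s\<^sup>2 + snd x)))"
      by (intro integral_add integrable_continuous_interval continuous_on_mult_left c ig'[OF x])
    finally show "blinfun_apply (integral (cbox 0 1) (fx x)) h =
       fst h * integral {0..1} (\<lambda>s. (w s * s\<^sup>2) * g' (fst x * s\<^sup>2 + snd x))
        + snd h * integral {0..1} (\<lambda>s. w s * g' (fst x * s\<^sup>2 + snd x))"
      by simp
  qed
  ultimately show ?thesis by (simp add: cbox_interval)
qed

text \<open>The induction generalises over the weight, since each derivative changes it. One order
  of \<open>g\<close> is lost because continuity in the base case is deduced from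
  differentiability.\<close>

lemma diffk_on_param_integral:
  fixes g w :: "real \<Rightarrow> real"
  assumes "diffk_on (Suc k) {0<..} g" "continuous_on {0..1} w"
  shows "diffk_on k ({0<..} \<times> {0<..}) (\<lambda>x. integral {0..1} (\<lambda>s. w s * g (fst x * s\<^sup>2 + snd x)))"
  using assms
proof (induction k arbitrary: g w)
  case 0
  obtain Dg where Dg [rule_format]:
    "\<forall>z\<in>{0<..}. (g has_derivative (\<lambda>h. \<Sum>i\<in>Basis. (h \<bullet> i) * Dg i z)) (at z within {0<..})"
    "\<forall>i\<in>Basis. diffk_on 0 {0<..} (Dg i)"
    using diffk_on_SucE[OF 0(1)] by blast
  have d: "(g has_real_derivative Dg 1 z) (at z)" if "z > 0" for z
    using Dg(1)[of z] that at_within_open[of z "{0<..}"] by (simp add: has_field_derivative_def mult_commute_abs)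
  have "continuous_on {0<..} (Dg 1)" using Dg(2)[of 1] by simp
  from has_derivative_continuous_on[OF has_derivative_param_integral[OF d this 0(2)]]
  show ?case unfolding diffk_on.simps(1) .
next
  case (Suc k)
  obtain Dg where Dg [rule_format]:
    "\<forall>z\<in>{0<..}. (g has_derivative (\<lambda>h. \<Sum>i\<in>Basis. (h \<bullet> i) * Dg i z)) (at z within {0<..})"
    "\<forall>i\<in>Basis. diffk_on (Suc k) {0<..} (Dg i)"
    using diffk_on_SucE[OF Suc.prems(1)] by blast
  have d: "(g has_real_derivative Dg 1 z) (at z)" if "z > 0" for z
    using Dg(1)[of z] that at_within_open[of z "{0<..}"] by (simp add: has_field_derivative_def mult_commute_abs)
  have dk: "diffk_on (Suc k) {0<..} (Dg 1)" using Dg(2)[of 1] by simp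
  have w: "continuous_on {0..1} (\<lambda>s. w s * s\<^sup>2)" by (intro continuous_intros Suc.prems)
  let ?D = "\<lambda>i x. if i = (1, 0) then integral {0..1} (\<lambda>s. w s * s\<^sup>2 * Dg 1 (fst x * s\<^sup>2 + snd x))
      else integral {0..1} (\<lambda>s. w s * Dg 1 (fst x * s\<^sup>2 + snd x))"
  show ?case
  proof (rule diffk_on_SucI[where Df="?D"])
    fix x :: "real \<times> real" assume x: "x \<in> {0<..} \<times> {0<..}"
    have B: "(Basis :: (real \<times> real) set) = {(1, 0), (0, 1)}"
      by (auto simp: Basis_prod_def)
    have "(\<lambda>h. \<Sum>i\<in>Basis. (h \<bullet> i) * ?D i x) =
      (\<lambda>h. fst h * integral {0..1} (\<lambda>s. (w s * s\<^sup>2) * Dg 1 (fst x * s\<^sup>2 + snd x))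
        + snd h * integral {0..1} (\<lambda>s. w s * Dg 1 (fst x * s\<^sup>2 + snd x)))"
      unfolding B by (auto simp: inner_prod_def)
    with has_derivative_param_integral[OF d diffk_on_imp_continuous_on[OF dk] Suc.prems(2) x]
    show "((\<lambda>x. integral {0..1} (\<lambda>s. w s * g (fst x * s\<^sup>2 + snd x))) has_derivative
        (\<lambda>h. \<Sum>i\<in>Basis. (h \<bullet> i) * ?D i x)) (at x within {0<..} \<times> {0<..})"
      by simp
  next
    fix i :: "real \<times> real" assume "i \<in> Basis"
    show "diffk_on k ({0<..} \<times> {0<..}) (?D i)"
      using Suc.IH[OF dk w] Suc.IH[OF dk Suc.prems(2)] by (cases "i = (1, 0)") simp_all
  qed
qed

lemma integral_scale_01:
  fixes f :: "real \<Rightarrow> real"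
  assumes "m > 0" "continuous_on {0..m} f"
  shows "integral {0..m} f = m * integral {0..1} (\<lambda>s. f (m * s))"
proof -
  have "continuous_on {0..1} (\<lambda>s. f (m * s))"
    using assms(1) by (intro continuous_on_compose2[OF assms(2)]) (auto intro!: continuous_intros mult_left_le)
  then have "((\<lambda>s. f (m * s)) has_integral integral {0..1} (\<lambda>s. f (m * s))) {0..1}"
    by (intro integrable_integral integrable_continuous_interval)
  from has_integral_affinity01[OF this, of "1 / m" 0] assms(1)
  have "(f has_integral m * integral {0..1} (\<lambda>s. f (m * s))) ((\<lambda>x. x * m) ` {0..1})"
    by simp
  moreover have "(\<lambda>x. x * m) ` {0..1} = {0..m}"
    using assms(1) image_mult_atLeastAtMost[of m 0 1] by (simp add: mult.commute[of _ m])
  ultimately show ?thesis by (simp add: integral_unique)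
qed

subsection \<open>The gap function and its derivatives\<close>

definition tanhc :: "real \<Rightarrow> real" where
  "tanhc x = (if x = 0 then 1 else tanh x / x)"

lemma mult_tanhc: "x * tanhc x = tanh x"
  by (simp add: tanhc_def)

lemma tanhc_nonzero: "x \<noteq> 0 \<Longrightarrow> tanhc x = tanh x / x"
  by (simp add: tanhc_def)

lemma one_minus_tanh_square_pos: "0 < 1 - (tanh x)\<^sup>2" for x :: real
proof -
  have "\<bar>tanh x\<bar> < 1" using tanh_real_bounds[of x] by auto
  then show ?thesis by (simp add: abs_square_less_1)
qed

lemma tanhc_pos: "tanhc x > 0"
  by (auto simp: tanhc_def zero_less_divide_iff)

lemma continuous_on_tanhc [continuous_intros]:
  assumes "continuous_on S f" shows "continuous_on S (\<lambda>x. tanhc (f x))"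
proof -
  have "isCont tanhc x" for x
  proof (cases "x = 0")
    case True
    \<comment> \<open>The quotient \<open>tanh h / h\<close> is the difference quotient of
      \<open>tanh\<close> at 0, so the value 1 of \<open>tanhc\<close> is the derivative of
      \<open>tanh\<close> there.\<close>
    have "(\<lambda>h. (tanh (0 + h) - tanh 0) / h) \<midarrow>0\<rightarrow> (1 - (tanh 0)\<^sup>2 :: real)"
      using DERIV_tanh_real[of 0] by (simp only: DERIV_def)
    then have "(\<lambda>h. tanh h / h) \<midarrow>0\<rightarrow> (1::real)" by simp
    then have "tanhc \<midarrow>0\<rightarrow> 1"
      by (rule Lim_transform_eventually) (auto simp: eventually_at_filter tanhc_def)
    then show ?thesis by (simp add: isCont_def True tanhc_def)
  next
    case False
    have "isCont (\<lambda>x. tanh x / x) x" using False by (auto intro!: continuous_intros)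
    moreover have "eventually (\<lambda>y. tanh y / y = tanhc y) (at x)"
      by (rule eventually_at_in_open'[of "- {0}", THEN eventually_mono]) (use False in \<open>auto simp: tanhc_def\<close>)
    ultimately show ?thesis using False unfolding isCont_def
      by (auto simp: tanhc_def intro: Lim_transform_eventually)
  qed
  then have "continuous_on UNIV tanhc" by (simp add: continuous_at_imp_continuous_on)
  then show ?thesis by (rule continuous_on_compose2) (use assms in auto)
qed

lemma tanh_le_self: "0 \<le> x \<Longrightarrow> tanh x \<le> (x::real)"
proof -
  assume "0 \<le> x"
  then have "0 - tanh 0 \<le> x - tanh x"
    by (rule DERIV_nonneg_imp_nondecreasing) (auto intro!: exI derivative_eq_intros)
  then show ?thesis by simp
qed

lemma tanhc_le_1: "0 \<le> x \<Longrightarrow> tanhc x \<le> 1"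
  using tanh_le_self[of x] by (auto simp: tanhc_def)

definition dtanhc :: "real \<Rightarrow> real" where
  "dtanhc x = (x * (1 - (tanh x)\<^sup>2) - tanh x) / x\<^sup>2"

lemma DERIV_tanhc:
  assumes "x > 0" shows "(tanhc has_real_derivative dtanhc x) (at x)"
proof -
  have "((\<lambda>x. tanh x / x) has_real_derivative dtanhc x) (at x)"
    using assms by (auto intro!: derivative_eq_intros simp: dtanhc_def power2_eq_square field_simps)
  then show ?thesis
    by (rule has_field_derivative_transform_within_open[of _ _ _ "{0<..}"]) (use assms in \<open>auto simp: tanhc_def\<close>)
qed

text \<open>Up to the sign and the factor \<open>x\<^sup>2\<close>, \<open>dtanhc\<close> is the
  function \<open>?g\<close>, which vanishes at 0 and has the positive derivative
  \<open>2 * y * tanh y * (1 - (tanh y)\<^sup>2)\<close>.\<close>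

lemma dtanhc_neg: "x > 0 \<Longrightarrow> dtanhc x < 0"
proof -
  assume x: "x > 0"
  let ?g = "\<lambda>x::real. tanh x - x * (1 - (tanh x)\<^sup>2)"
  have "?g 0 < ?g x"
  proof (rule DERIV_pos_imp_increasing_open[OF x])
    fix y :: real assume "0 < y"
    have "(?g has_real_derivative 2 * y * tanh y * (1 - (tanh y)\<^sup>2)) (at y)"
      by (auto intro!: derivative_eq_intros simp: algebra_simps)
    moreover have "2 * y * tanh y * (1 - (tanh y)\<^sup>2) > 0"
      using \<open>0 < y\<close> one_minus_tanh_square_pos by (intro mult_pos_pos) auto
    ultimately show "\<exists>d. (?g has_real_derivative d) (at y) \<and> d > 0" by blast
  qed (auto intro!: continuous_intros)
  then show ?thesis using x by (simp add: dtanhc_def divide_neg_pos)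
qed

lemma continuous_on_dtanhc: "continuous_on {0<..} dtanhc"
  unfolding dtanhc_def by (intro continuous_intros) auto

lemma tanhc_antimono:
  assumes "0 < x" "x \<le> y" shows "tanhc y \<le> tanhc x"
  using assms(2)
proof (rule DERIV_nonpos_imp_nonincreasing)
  fix z assume "x \<le> z"
  then have "z > 0" using assms(1) by simp
  then show "\<exists>d. (tanhc has_real_derivative d) (at z) \<and> d \<le> 0"
    using DERIV_tanhc dtanhc_neg less_imp_le by blast
qed

text \<open>The derivative of \<open>ln (cosh (b * E)) / b\<close> in \<open>b\<close> is this
  expression at \<open>b * E\<close>, divided by \<open>b\<^sup>2\<close>. Its monotonicity gives
  the sign of the closed-form part of the gap function under a change of temperature.\<close>

lemma mult_tanh_minus_ln_cosh_mono:
  assumes "0 \<le> x" "x \<le> (y::real)"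
  shows "x * tanh x - ln (cosh x) \<le> y * tanh y - ln (cosh y)"
  using assms(2)
proof (rule DERIV_nonneg_imp_nondecreasing)
  fix z assume "x \<le> z"
  have "((\<lambda>x. x * tanh x - ln (cosh x)) has_real_derivative z * (1 - (tanh z)\<^sup>2)) (at z)"
    using DERIV_diff[OF DERIV_mult[OF DERIV_ident DERIV_tanh_real] DERIV_ln_cosh, of z] by (simp add: algebra_simps)
  moreover have "z * (1 - (tanh z)\<^sup>2) \<ge> 0"
    using \<open>x \<le> z\<close> assms(1) one_minus_tanh_square_pos[of z] by simp
  ultimately show "\<exists>d. ((\<lambda>x. x * tanh x - ln (cosh x)) has_real_derivative d) (at z) \<and> d \<ge> 0" by blast
qed

text \<open>Both integrals of the paper are written with \<open>b = 1 / (2 T)\<close> and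
  \<open>tanh (b E) / E = b * tanhc (b E)\<close>, which has no singularity at \<open>E = 0\<close>.\<close>

definition gap_int :: "real \<Rightarrow> real \<Rightarrow> real \<Rightarrow> real" where
  "gap_int mu b D = integral {0..mu} (\<lambda>xi. b * tanhc (b * sqrt (xi\<^sup>2 + D\<^sup>2)))"

definition gap_fun :: "real \<Rightarrow> real \<Rightarrow> real \<Rightarrow> real \<Rightarrow> real" where
  "gap_fun xm mu b D = (ln (cosh (b * sqrt (xm\<^sup>2 + D\<^sup>2))) - ln (cosh (b * sqrt (mu\<^sup>2 + D\<^sup>2)))) / b
     + mu * gap_int mu b D"

text \<open>The integrands differ only at \<open>xi = 0\<close> when \<open>D = 0\<close>: division
  by zero yields 0 on the left, while the right has the value \<open>b\<close>. A single point does
  not affect the integral.\<close>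

lemma gap_int_eq:
  assumes "b > 0"
  shows "integral {0..mu} (\<lambda>xi. tanh (b * sqrt (xi\<^sup>2 + D\<^sup>2)) / sqrt (xi\<^sup>2 + D\<^sup>2)) = gap_int mu b D"
  unfolding gap_int_def
  by (rule integral_spike[of "{0}"]) (use assms in \<open>auto simp: tanhc_def sum_power2_eq_zero_iff\<close>)

lemma gap_rhs_eq:
  assumes "T > 0"
  shows "gap_rhs xm mu T D = gap_fun xm mu (1 / (2 * T)) D * D"
proof -
  have "integral {0..mu} (\<lambda>xi. tanh (sqrt (xi\<^sup>2 + D\<^sup>2) / (2 * T)) * D / sqrt (xi\<^sup>2 + D\<^sup>2))
    = gap_int mu (1 / (2 * T)) D * D"
    using assms by (subst gap_int_eq[symmetric]) (simp_all flip: integral_mult_left)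
  then show ?thesis
    using assms unfolding gap_rhs_def gap_fun_def
    by (simp add: ln_div algebra_simps)
qed

lemma gap_eq_iff:
  assumes "T > 0"
  shows "gap_eq xm mu lam T D \<longleftrightarrow> D = 0 \<or> gap_fun xm mu (1 / (2 * T)) D = xm / lam"
  unfolding gap_eq_def gap_rhs_eq[OF assms] mult_cancel_right by auto

lemma Tc_eq_iff:
  assumes "T > 0" "mu > 0" "xm > 0"
  shows "Tc_eq xm mu lam T \<longleftrightarrow> gap_fun xm mu (1 / (2 * T)) 0 = xm / lam"
proof -
  have "integral {0..mu} (\<lambda>xi. tanh (xi / (2 * T)) / xi) = gap_int mu (1 / (2 * T)) 0"
    unfolding gap_int_eq[symmetric, OF divide_pos_pos[OF zero_less_one mult_pos_pos[OF zero_less_numeral assms(1)]]]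
    by (intro integral_cong) auto
  then show ?thesis
    using assms unfolding Tc_eq_def gap_fun_def
    by (auto simp add: ln_div algebra_simps)
qed

lemma gap_int_pos:
  assumes "b > 0" "mu > 0" shows "gap_int mu b D > 0"
proof -
  have "integral {0..mu} (\<lambda>_. 0) < gap_int mu b D"
    unfolding gap_int_def
    by (rule integral_less_real) (use assms tanhc_pos in \<open>auto intro!: continuous_intros\<close>)
  then show ?thesis by simp
qed

lemma continuous_on_gap_int:
  assumes "mu \<ge> 0" shows "continuous_on UNIV (gap_int mu b)"
proof -
  have "continuous_on UNIV (\<lambda>D. integral (cbox 0 mu) (\<lambda>xi. b * tanhc (b * sqrt (xi\<^sup>2 + D\<^sup>2))))"
    by (rule integral_continuous_on_param) (auto simp: case_prod_beta intro!: continuous_intros)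
  then show ?thesis unfolding gap_int_def by (simp add: cbox_interval)
qed

lemma continuous_on_gap_fun:
  assumes "mu \<ge> 0" "b > 0" shows "continuous_on S (gap_fun xm mu b)"
  unfolding gap_fun_def using assms
  by (intro continuous_intros continuous_on_subset[OF continuous_on_gap_int]) auto

section \<open>Partial derivatives of the gap function\<close>

lemma DERIV_ln_cosh_sqrt:
  assumes "b > 0" "x\<^sup>2 + D\<^sup>2 > (0::real)"
  shows "((\<lambda>D. ln (cosh (b * sqrt (x\<^sup>2 + D\<^sup>2)))) has_real_derivative
           tanh (b * sqrt (x\<^sup>2 + D\<^sup>2)) * (b * D / sqrt (x\<^sup>2 + D\<^sup>2))) (at D)"
proof -
  have "((\<lambda>D. b * sqrt (x\<^sup>2 + D\<^sup>2)) has_real_derivative b * D / sqrt (x\<^sup>2 + D\<^sup>2)) (at D)"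
    using assms by (auto intro!: derivative_eq_intros simp: field_simps)
  from DERIV_chain2[OF DERIV_ln_cosh this] show ?thesis .
qed

text \<open>The closed-form part contributes \<open>b * D\<close> times a difference of values of
  \<open>tanhc\<close> at \<open>xm\<close> and \<open>mu\<close>, which is nonpositive because
  \<open>tanhc\<close> decreases and \<open>mu \<le> xm\<close>. Strictness comes from the integral,
  whose integrand has a negative derivative throughout.\<close>

lemma DERIV_gap_fun_D:
  assumes "0 < mu" "mu \<le> xm" "b > 0" "D > 0"
  shows "\<exists>c<0. (gap_fun xm mu b has_real_derivative c) (at D)"
proof -
  let ?E = "\<lambda>x D. sqrt (x\<^sup>2 + D\<^sup>2)"
  let ?f = "\<lambda>D xi. b * (dtanhc (b * ?E xi D) * (b * D / ?E xi D))"
  have E: "?E x D > 0" if "D > 0" for x D :: real using that by (simp add: add_nonneg_pos)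
  have cont: "continuous_on ({0<..} \<times> cbox 0 mu) (\<lambda>(D, xi). ?f D xi)"
    unfolding case_prod_beta using assms(3) E
    by (intro continuous_intros continuous_on_compose2[OF continuous_on_dtanhc]) (auto simp: less_imp_neq[symmetric])
  have "((\<lambda>D. integral (cbox 0 mu) (\<lambda>xi. b * tanhc (b * ?E xi D))) has_real_derivative
      integral (cbox 0 mu) (?f D)) (at D within {0<..})"
  proof (rule leibniz_rule_field_derivative[OF _ _ cont])
    fix D xi :: real assume D: "D \<in> {0<..}"
    then have p: "xi\<^sup>2 + D\<^sup>2 > 0" by (simp add: add_nonneg_pos)
    have "((\<lambda>D. b * ?E xi D) has_real_derivative b * D / ?E xi D) (at D within {0<..})"
      using p by (auto intro!: derivative_eq_intros simp: field_simps)
    from DERIV_cmult[OF DERIV_chain2[OF DERIV_tanhc this]]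
    show "((\<lambda>D. b * tanhc (b * ?E xi D)) has_real_derivative ?f D xi) (at D within {0<..})"
      using E D assms(3) by simp
  qed (use assms in \<open>auto intro!: integrable_continuous_interval continuous_intros simp: cbox_interval\<close>)
  then have I: "(gap_int mu b has_real_derivative integral {0..mu} (?f D)) (at D)"
    using assms at_within_open[of D "{0<..}"] unfolding gap_int_def by (simp add: cbox_interval)
  have "integral {0..mu} (?f D) < integral {0..mu} (\<lambda>_. 0)"
  proof (rule integral_less_real)
    have "continuous_on {0..mu} (\<lambda>xi. (\<lambda>(D, xi). ?f D xi) (D, xi))"
      by (rule continuous_on_compose2[OF cont]) (use assms in \<open>auto intro!: continuous_intros simp: cbox_interval\<close>)
    then show "continuous_on {0..mu} (?f D)" by simp
    show "?f D xi < 0" for xi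
      using assms E by (intro mult_pos_neg mult_neg_pos dtanhc_neg divide_pos_pos mult_pos_pos)
  qed (use assms in auto)
  then have neg: "mu * integral {0..mu} (?f D) < 0" using assms(1) by (simp add: mult_pos_neg)
  let ?c = "(tanh (b * ?E xm D) * (b * D / ?E xm D) - tanh (b * ?E mu D) * (b * D / ?E mu D)) / b"
  have p: "x\<^sup>2 + D\<^sup>2 > 0" for x using assms by (simp add: add_nonneg_pos)
  have "(gap_fun xm mu b has_real_derivative ?c + mu * integral {0..mu} (?f D)) (at D)"
    unfolding gap_fun_def
    by (intro DERIV_add DERIV_cdivide DERIV_diff DERIV_cmult I DERIV_ln_cosh_sqrt assms p)
  moreover have "?c \<le> 0"
  proof -
    have "?c = b * D * (tanhc (b * ?E xm D) - tanhc (b * ?E mu D))"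
      using E[OF assms(4)] assms(3) by (simp add: tanhc_def field_simps less_imp_neq[symmetric])
    moreover have "tanhc (b * ?E xm D) \<le> tanhc (b * ?E mu D)"
      using E[OF assms(4)] assms by (intro tanhc_antimono) auto
    ultimately show ?thesis using assms by (simp add: mult_nonneg_nonpos)
  qed
  ultimately show ?thesis using neg by (intro exI[of _ "?c + mu * integral {0..mu} (?f D)"]) auto
qed

text \<open>The integrand \<open>tanh (b * E) / E\<close> has the derivative
  \<open>1 - (tanh (b * E))\<^sup>2 > 0\<close>, which gives strictness. Here \<open>D\<close> is
  arbitrary; the value \<open>D = 0\<close> serves the critical temperature.\<close>

lemma DERIV_gap_fun_b:
  assumes "0 < mu" "mu \<le> xm" "b > 0"
  shows "\<exists>c>0. ((\<lambda>b. gap_fun xm mu b D) has_real_derivative c) (at b)"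
proof -
  let ?E = "\<lambda>x. sqrt (x\<^sup>2 + D\<^sup>2)"
  let ?f = "\<lambda>b xi. 1 - (tanh (b * ?E xi))\<^sup>2"
  have cont: "continuous_on ({0<..} \<times> cbox 0 mu) (\<lambda>(b, xi). ?f b xi)"
    unfolding case_prod_beta by (intro continuous_intros) auto
  have "((\<lambda>b. integral (cbox 0 mu) (\<lambda>xi. b * tanhc (b * ?E xi))) has_real_derivative
      integral (cbox 0 mu) (?f b)) (at b within {0<..})"
  proof (rule leibniz_rule_field_derivative[OF _ _ cont])
    fix b xi :: real assume b: "b \<in> {0<..}"
    show "((\<lambda>b. b * tanhc (b * ?E xi)) has_real_derivative ?f b xi) (at b within {0<..})"
    proof (cases "?E xi = 0")
      \<comment> \<open>At \<open>E = 0\<close> the integrand is \<open>b\<close> itself, with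
        derivative 1, in agreement with the general formula.\<close>
      case True
      then show ?thesis by (auto simp: tanhc_def intro!: derivative_eq_intros)
    next
      case False
      have "b * tanhc (b * ?E xi) = tanh (b * ?E xi) / ?E xi" for b
        using mult_tanhc[of "b * ?E xi"] False by (simp add: field_simps)
      moreover have "((\<lambda>b. b * ?E xi) has_real_derivative ?E xi) (at b within {0<..})"
        by (auto intro!: derivative_eq_intros)
      from DERIV_cdivide[OF DERIV_chain2[OF DERIV_tanh_real this], of "?E xi"]
      have "((\<lambda>b. tanh (b * ?E xi) / ?E xi) has_real_derivative ?f b xi) (at b within {0<..})"
        unfolding nonzero_mult_div_cancel_right[OF False] .
      ultimately show ?thesis by simp
    qed
  qed (use assms in \<open>auto intro!: integrable_continuous_interval continuous_intros simp: cbox_interval\<close>)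
  then have I: "((\<lambda>b. gap_int mu b D) has_real_derivative integral {0..mu} (?f b)) (at b)"
    using assms at_within_open[of b "{0<..}"] unfolding gap_int_def by (simp add: cbox_interval)
  have "integral {0..mu} (\<lambda>_. 0) < integral {0..mu} (?f b)"
    by (rule integral_less_real) (use assms one_minus_tanh_square_pos in \<open>auto intro!: continuous_intros\<close>)
  then have pos: "mu * integral {0..mu} (?f b) > 0" using assms(1) by simp
  let ?M = "\<lambda>x. b * ?E x * tanh (b * ?E x) - ln (cosh (b * ?E x))"
  have L: "((\<lambda>b. ln (cosh (b * ?E x)) / b) has_real_derivative ?M x / b\<^sup>2) (at b)" for x
  proof -
    have "((\<lambda>b. b * ?E x) has_real_derivative ?E x) (at b)" by (auto intro!: derivative_eq_intros)
    from DERIV_divide[OF DERIV_chain2[OF DERIV_ln_cosh this] DERIV_ident] assms(3)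
    show ?thesis by (simp add: power2_eq_square algebra_simps)
  qed
  have "((\<lambda>b. gap_fun xm mu b D) has_real_derivative (?M xm / b\<^sup>2 - ?M mu / b\<^sup>2) + mu * integral {0..mu} (?f b)) (at b)"
    unfolding gap_fun_def diff_divide_distrib
    by (intro DERIV_add DERIV_diff DERIV_cmult I L[unfolded diff_divide_distrib])
  moreover have "?M mu / b\<^sup>2 \<le> ?M xm / b\<^sup>2"
    using assms by (intro divide_right_mono mult_tanh_minus_ln_cosh_mono mult_left_mono) auto
  ultimately show ?thesis using pos
    by (intro exI[of _ "(?M xm / b\<^sup>2 - ?M mu / b\<^sup>2) + mu * integral {0..mu} (?f b)"]) auto
qed

text \<open>The contribution of the moving end point, \<open>mu * tanh (b * E) / E\<close>, cancels
  against the derivative of the closed-form part. Only the derivative of the explicit factor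
  \<open>mu\<close> survives.\<close>

lemma DERIV_gap_fun_mu:
  assumes "0 < mu" "b > 0"
  shows "((\<lambda>mu. gap_fun xm mu b D) has_real_derivative gap_int mu b D) (at mu)"
proof -
  let ?E = "\<lambda>x. sqrt (x\<^sup>2 + D\<^sup>2)"
  have p: "mu\<^sup>2 + D\<^sup>2 > 0" using assms by (simp add: add_pos_nonneg)
  \<comment> \<open>The interval extends beyond \<open>mu\<close> so that \<open>mu\<close> is an
    interior point and the derivative becomes two-sided.\<close>
  have "((\<lambda>mu. gap_int mu b D) has_real_derivative b * tanhc (b * ?E mu)) (at mu within {0..mu + 1})"
    unfolding gap_int_def using assms by (intro integral_has_real_derivative) (auto intro!: continuous_intros)
  then have I: "((\<lambda>mu. gap_int mu b D) has_real_derivative b * tanhc (b * ?E mu)) (at mu)"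
    using at_within_Icc_at[of 0 mu "mu + 1"] assms by simp
  have L: "((\<lambda>mu. ln (cosh (b * ?E mu))) has_real_derivative tanh (b * ?E mu) * (b * mu / ?E mu)) (at mu)"
    using DERIV_ln_cosh_sqrt[of b D mu] assms p by (simp add: add.commute)
  have "((\<lambda>mu. gap_fun xm mu b D) has_real_derivative
      (0 - tanh (b * ?E mu) * (b * mu / ?E mu)) / b + (1 * gap_int mu b D + b * tanhc (b * ?E mu) * mu)) (at mu)"
    unfolding gap_fun_def
    by (intro DERIV_add DERIV_cdivide DERIV_diff DERIV_const DERIV_mult I L DERIV_ident)
  moreover have "(0 - tanh (b * ?E mu) * (b * mu / ?E mu)) / b + (1 * gap_int mu b D + b * tanhc (b * ?E mu) * mu)
      = gap_int mu b D"
    using p assms by (simp add: tanhc_def field_simps)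
  ultimately show ?thesis by simp
qed

subsection \<open>Smoothness, the zero-temperature limit and bounds\<close>

text \<open>The substitution \<open>xi = m x * s\<close> fixes the interval and produces
  \<open>?g\<close> at \<open>(b x)\<^sup>2 * (m x)\<^sup>2 * s\<^sup>2 + (b x)\<^sup>2 * (d
  x)\<^sup>2\<close>. Positivity of \<open>d x\<close> keeps this argument in the region where
  \<open>?g\<close> is smooth.\<close>

lemma diffk_on_gap_int:
  assumes "diffk_on k S m" "diffk_on k S b" "diffk_on k S d"
    and pos: "\<And>x. x \<in> S \<Longrightarrow> m x > 0 \<and> b x > 0 \<and> d x > 0"
  shows "diffk_on k S (\<lambda>x. gap_int (m x) (b x) (d x))"
proof -
  let ?g = "\<lambda>z::real. tanh (sqrt z) / sqrt z"
  let ?Q = "\<lambda>x. integral {0..1} (\<lambda>s. (\<lambda>_. 1) s * ?g (fst x * s\<^sup>2 + snd x))"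
  have "diffk_on (Suc k) {0<..} (\<lambda>z::real. sqrt z)"
    by (intro diffk_on_sqrt diffk_on_linear bounded_linear_ident) auto
  then have "diffk_on (Suc k) {0<..} ?g"
    by (intro diffk_on_divide diffk_on_tanh) auto
  from diffk_on_param_integral[OF this, of "\<lambda>_. 1"]
  have Q: "diffk_on k ({0<..} \<times> {0<..}) ?Q" by simp
  have "diffk_on k S (\<lambda>x. ?Q ((b x)\<^sup>2 * (m x)\<^sup>2, (b x)\<^sup>2 * (d x)\<^sup>2))"
    by (rule diffk_on_compose_Pair[OF Q])
       (use assms in \<open>auto intro!: diffk_on_mult diffk_on_power dest: pos\<close>)
  then have "diffk_on k S (\<lambda>x. m x * b x * ?Q ((b x)\<^sup>2 * (m x)\<^sup>2, (b x)\<^sup>2 * (d x)\<^sup>2))"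
    by (intro diffk_on_mult assms)
  then show ?thesis
  proof (rule diffk_on_cong)
    fix x assume "x \<in> S"
    with pos have p: "m x > 0" "b x > 0" "d x > 0" by auto
    have "gap_int (m x) (b x) (d x) = m x * integral {0..1} (\<lambda>s. b x * tanhc (b x * sqrt ((m x * s)\<^sup>2 + (d x)\<^sup>2)))"
      unfolding gap_int_def using p by (intro integral_scale_01) (auto intro!: continuous_intros)
    also have "(\<lambda>s. b x * tanhc (b x * sqrt ((m x * s)\<^sup>2 + (d x)\<^sup>2)))
      = (\<lambda>s. b x * ?g ((b x)\<^sup>2 * (m x)\<^sup>2 * s\<^sup>2 + (b x)\<^sup>2 * (d x)\<^sup>2))"
    proof
      fix s
      have "sqrt ((b x)\<^sup>2 * (m x)\<^sup>2 * s\<^sup>2 + (b x)\<^sup>2 * (d x)\<^sup>2) = sqrt ((b x)\<^sup>2 * ((m x * s)\<^sup>2 + (d x)\<^sup>2))"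
        by (simp add: algebra_simps)
      also have "\<dots> = b x * sqrt ((m x * s)\<^sup>2 + (d x)\<^sup>2)"
        using p by (simp add: real_sqrt_mult)
      finally have e: "sqrt ((b x)\<^sup>2 * (m x)\<^sup>2 * s\<^sup>2 + (b x)\<^sup>2 * (d x)\<^sup>2) = b x * sqrt ((m x * s)\<^sup>2 + (d x)\<^sup>2)" .
      have "(m x * s)\<^sup>2 + (d x)\<^sup>2 > 0" using p by (simp add: add_nonneg_pos)
      then have nz: "b x * sqrt ((m x * s)\<^sup>2 + (d x)\<^sup>2) \<noteq> 0" using p by simp
      show "b x * tanhc (b x * sqrt ((m x * s)\<^sup>2 + (d x)\<^sup>2)) = b x * ?g ((b x)\<^sup>2 * (m x)\<^sup>2 * s\<^sup>2 + (b x)\<^sup>2 * (d x)\<^sup>2)"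
        unfolding e tanhc_nonzero[OF nz] ..
    qed
    finally show "gap_int (m x) (b x) (d x) = m x * b x * ?Q ((b x)\<^sup>2 * (m x)\<^sup>2, (b x)\<^sup>2 * (d x)\<^sup>2)"
      by (simp only: integral_mult_right mult_1 mult.assoc fst_conv snd_conv)
  qed
qed

text \<open>Serves the case \<open>D = 0\<close>, in which the argument of the previous substitution
  reaches 0. Scaling by \<open>b\<close> turns the gap integral into this primitive at
  \<open>b * mu > 0\<close>, where smoothness follows from that of
  \<open>tanh x / x\<close>.\<close>

definition tanhc_int :: "real \<Rightarrow> real" where
  "tanhc_int u = integral {0..u} tanhc"

lemma DERIV_tanhc_int:
  assumes "u > 0" shows "(tanhc_int has_real_derivative tanhc u) (at u)"
proof -
  have "(tanhc_int has_real_derivative tanhc u) (at u within {0..u + 1})"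
    unfolding tanhc_int_def using assms by (intro integral_has_real_derivative) (auto intro!: continuous_intros)
  then show ?thesis using at_within_Icc_at[of 0 u "u + 1"] assms by simp
qed

lemma diffk_on_tanhc_int: "diffk_on k {0<..} tanhc_int"
proof (cases k)
  case 0
  have "continuous_on {0<..} tanhc_int"
    by (intro continuous_at_imp_continuous_on ballI DERIV_isCont) (auto intro: DERIV_tanhc_int)
  with 0 show ?thesis by simp
next
  case (Suc n)
  have "diffk_on n {0<..} (\<lambda>x::real. tanh x / x)"
    by (intro diffk_on_divide diffk_on_tanh diffk_on_linear bounded_linear_ident) auto
  then have "diffk_on n {0<..} tanhc" by (rule diffk_on_cong) (auto simp: tanhc_def)
  moreover have "(tanhc_int has_derivative (\<lambda>h. \<Sum>i\<in>Basis. (h \<bullet> i) * tanhc x)) (at x within {0<..})"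
    if "x \<in> {0<..}" for x
    using has_derivative_at_withinI[OF DERIV_tanhc_int[of x, unfolded has_field_derivative_def]] that
    by (simp add: mult_commute_abs)
  ultimately show ?thesis unfolding Suc by (intro diffk_on_SucI[where Df="\<lambda>_. tanhc"])
qed

lemma gap_int_0:
  assumes "mu > 0" "b > 0" shows "gap_int mu b 0 = tanhc_int (b * mu)"
proof -
  have "gap_int mu b 0 = integral {0..mu} (\<lambda>xi. b * tanhc (b * xi))"
    unfolding gap_int_def by (intro integral_cong) auto
  also have "\<dots> = mu * integral {0..1} (\<lambda>s. b * tanhc (b * (mu * s)))"
    using assms by (intro integral_scale_01) (auto intro!: continuous_intros)
  also have "\<dots> = (b * mu) * integral {0..1} (\<lambda>s. tanhc (b * mu * s))" by (simp add: mult.assoc)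
  also have "\<dots> = tanhc_int (b * mu)"
    unfolding tanhc_int_def using assms
    by (intro integral_scale_01[symmetric]) (auto intro!: continuous_intros)
  finally show ?thesis .
qed

lemma diffk_on_gap_int_0:
  assumes "diffk_on k S m" "diffk_on k S b"
    and pos: "\<And>x. x \<in> S \<Longrightarrow> m x > 0 \<and> b x > 0"
  shows "diffk_on k S (\<lambda>x. gap_int (m x) (b x) 0)"
proof -
  have "diffk_on k S (\<lambda>x. tanhc_int (b x * m x))"
    by (rule diffk_on_compose_real[OF diffk_on_tanhc_int]) (auto intro: diffk_on_mult assms dest: pos)
  then show ?thesis by (rule diffk_on_cong) (auto simp: gap_int_0 pos)
qed

text \<open>Smoothness of the integral enters as a hypothesis so that both cases,
  \<open>d x > 0\<close> and \<open>d\<close> identically 0, are covered. The square roots are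
  harmless in either case because \<open>xm\<close> and \<open>m x\<close> are positive.\<close>

lemma diffk_on_gap_fun:
  assumes "diffk_on k S m" "diffk_on k S b" "diffk_on k S d"
    and pos: "\<And>x. x \<in> S \<Longrightarrow> m x > 0 \<and> b x > 0" and "xm > 0"
    and int: "diffk_on k S (\<lambda>x. gap_int (m x) (b x) (d x))"
  shows "diffk_on k S (\<lambda>x. gap_fun xm (m x) (b x) (d x))"
  unfolding gap_fun_def
  by (intro diffk_on_add diffk_on_mult diffk_on_divide diffk_on_diff diffk_on_ln_cosh
      diffk_on_sqrt diffk_on_power diffk_on_const assms)
    (use \<open>xm > 0\<close> in \<open>auto intro!: add_pos_nonneg dest: pos\<close>)

text \<open>The gap function with every \<open>tanh\<close> replaced by 1. The logarithm is
  \<open>arsinh (mu / D)\<close> for \<open>D > 0\<close>, the integral of \<open>1 / E\<close> over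
  \<open>{0..mu}\<close>.\<close>

definition gap0_fun :: "real \<Rightarrow> real \<Rightarrow> real \<Rightarrow> real" where
  "gap0_fun xm mu D = sqrt (xm\<^sup>2 + D\<^sup>2) - sqrt (mu\<^sup>2 + D\<^sup>2) + mu * ln ((mu + sqrt (mu\<^sup>2 + D\<^sup>2)) / D)"

lemma zeroT_eq_iff: "zeroT_eq xm mu lam D \<longleftrightarrow> gap0_fun xm mu D = xm / lam"
  unfolding zeroT_eq_def gap0_fun_def by auto

lemma diffk_on_gap0_fun:
  assumes "diffk_on k S m" "diffk_on k S d"
    and pos: "\<And>x. x \<in> S \<Longrightarrow> m x > 0 \<and> d x > 0" and "xm > 0"
  shows "diffk_on k S (\<lambda>x. gap0_fun xm (m x) (d x))"
  unfolding gap0_fun_def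
  by (intro diffk_on_add diffk_on_mult diffk_on_divide diffk_on_diff diffk_on_ln
      diffk_on_sqrt diffk_on_power diffk_on_const assms)
    (use \<open>xm > 0\<close> in \<open>auto intro!: add_pos_nonneg divide_pos_pos dest: pos\<close>)

lemma add_sqrt_pos: "D > 0 \<Longrightarrow> x + sqrt (x\<^sup>2 + D\<^sup>2) > (0::real)"
proof -
  assume "D > 0"
  then have "sqrt (x\<^sup>2) < sqrt (x\<^sup>2 + D\<^sup>2)" by (intro real_sqrt_less_mono) simp
  then show ?thesis by simp
qed

lemma DERIV_ln_add_sqrt:
  assumes "D > 0"
  shows "((\<lambda>x. ln (x + sqrt (x\<^sup>2 + D\<^sup>2))) has_real_derivative 1 / sqrt (x\<^sup>2 + D\<^sup>2)) (at x)"
proof -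
  let ?E = "sqrt (x\<^sup>2 + D\<^sup>2)"
  have p: "x\<^sup>2 + D\<^sup>2 > 0" using assms by (simp add: add_nonneg_pos)
  have "((\<lambda>x. x + sqrt (x\<^sup>2 + D\<^sup>2)) has_real_derivative 1 + x / ?E) (at x)"
    using p by (auto intro!: derivative_eq_intros simp: field_simps)
  from DERIV_chain2[OF DERIV_ln[OF add_sqrt_pos[OF assms]] this]
  have "((\<lambda>x. ln (x + sqrt (x\<^sup>2 + D\<^sup>2))) has_real_derivative inverse (x + ?E) * (1 + x / ?E)) (at x)" .
  moreover have "inverse (x + ?E) * (1 + x / ?E) = 1 / ?E"
  proof -
    have "?E > 0" using p by simp
    moreover have "1 + x / e = (x + e) / e" if "e > 0" for e using that by (simp add: field_simps)
    ultimately have "1 + x / ?E = (x + ?E) / ?E" by blast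
    then show ?thesis using add_sqrt_pos[OF assms, of x] by simp
  qed
  ultimately show ?thesis by simp
qed

lemma gap0_fun_eq:
  assumes "mu \<ge> 0" "D > 0"
  shows "gap0_fun xm mu D = sqrt (xm\<^sup>2 + D\<^sup>2) - sqrt (mu\<^sup>2 + D\<^sup>2) + mu * (ln (mu + sqrt (mu\<^sup>2 + D\<^sup>2)) - ln D)"
  unfolding gap0_fun_def using add_sqrt_pos[OF assms(2), of mu] assms by (simp add: ln_div)

text \<open>As at positive temperature, the terms \<open>mu / E\<close> cancel; what remains is the
  logarithm of \<open>(mu + E) / D\<close>, positive because \<open>E \<ge> D\<close>.\<close>

lemma DERIV_gap0_fun_mu:
  assumes "0 < mu" "D > 0"
  shows "\<exists>c>0. ((\<lambda>mu. gap0_fun xm mu D) has_real_derivative c) (at mu)"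
proof -
  let ?E = "\<lambda>x. sqrt (x\<^sup>2 + D\<^sup>2)"
  have p: "x\<^sup>2 + D\<^sup>2 > 0" for x using assms by (simp add: add_nonneg_pos)
  have E: "(?E has_real_derivative mu / ?E mu) (at mu)"
    using p[of mu] by (auto intro!: derivative_eq_intros simp: field_simps)
  have "((\<lambda>mu. ?E xm - ?E mu + mu * (ln (mu + ?E mu) - ln D)) has_real_derivative
     (0 - mu / ?E mu) + (1 * (ln (mu + ?E mu) - ln D) + (1 / ?E mu - 0) * mu)) (at mu)"
    by (intro DERIV_add DERIV_diff DERIV_const E DERIV_mult DERIV_ident DERIV_ln_add_sqrt assms)
  then have "((\<lambda>mu. gap0_fun xm mu D) has_real_derivative
     (0 - mu / ?E mu) + (1 * (ln (mu + ?E mu) - ln D) + (1 / ?E mu - 0) * mu)) (at mu)"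
    by (rule has_field_derivative_transform_within_open[of _ _ _ "{0<..}"]) (use assms in \<open>auto simp: gap0_fun_eq\<close>)
  moreover have "ln D < ln (mu + ?E mu)"
  proof -
    have "D \<le> ?E mu" by (simp add: real_le_rsqrt)
    then have "D < mu + ?E mu" using assms by linarith
    then show ?thesis using assms by (subst ln_less_cancel_iff) linarith+
  qed
  ultimately show ?thesis by (intro exI[of _ "ln (mu + ?E mu) - ln D"]) simp
qed

lemma DERIV_gap0_fun_D:
  assumes "0 < mu" "mu \<le> xm" "D > 0"
  shows "\<exists>c<0. ((\<lambda>D. gap0_fun xm mu D) has_real_derivative c) (at D)"
proof -
  let ?E = "\<lambda>x D. sqrt (x\<^sup>2 + D\<^sup>2)"
  have p: "x\<^sup>2 + D\<^sup>2 > 0" for x using assms by (simp add: add_nonneg_pos)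
  have E: "((\<lambda>D. ?E x D) has_real_derivative D / ?E x D) (at D)" for x
    using p[of x] by (auto intro!: derivative_eq_intros simp: field_simps)
  have E0: "?E x D > 0" for x using p by simp
  let ?c = "(D / ?E xm D - D / ?E mu D) + (inverse (mu + ?E mu D) * (0 + D / ?E mu D) - inverse D) * mu"
  have "((\<lambda>D. ?E xm D - ?E mu D + (ln (mu + ?E mu D) - ln D) * mu) has_real_derivative ?c) (at D)"
    using add_sqrt_pos[OF assms(3)]
    by (intro DERIV_add DERIV_diff DERIV_const E DERIV_cmult_right DERIV_ln assms(3)
      DERIV_chain2[where f=ln and g="\<lambda>D. mu + ?E mu D"])
  then have "((\<lambda>D. gap0_fun xm mu D) has_real_derivative ?c) (at D)"
    by (rule has_field_derivative_transform_within_open[of _ _ _ "{0<..}"])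
       (use assms in \<open>auto simp: gap0_fun_eq mult.commute\<close>)
  moreover have "D / ?E xm D \<le> D / ?E mu D"
    using assms E0 by (intro divide_left_mono) auto
  moreover have "inverse (mu + ?E mu D) * (0 + D / ?E mu D) < inverse D"
  proof -
    \<comment> \<open>This is the required bound \<open>D / (E * (mu + E)) < 1 / D\<close> after
      clearing denominators; it expresses that the logarithm decreases in \<open>D\<close>.\<close>
    have "D * D < ?E mu D * (mu + ?E mu D)"
    proof -
      have "?E mu D * ?E mu D = mu\<^sup>2 + D\<^sup>2" using p[of mu] by simp
      moreover have "?E mu D * mu > 0" using assms E0 by simp
      ultimately show ?thesis by (simp add: distrib_left power2_eq_square add_strict_increasing)
    qed
    moreover have "inverse (mu + e) * (0 + D / e) < inverse D" if "D * D < e * (mu + e)" "e > 0" for e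
    proof -
      have "D * D / (e * (mu + e)) < 1" using that assms by (subst divide_less_eq_1_pos) auto
      then have "inverse (mu + e) * (0 + D / e) * D < 1" by (simp add: divide_inverse mult_ac)
      then show ?thesis using assms by (simp only: inverse_eq_divide[of D] pos_less_divide_eq)
    qed
    ultimately show ?thesis using E0 by blast
  qed
  ultimately show ?thesis using assms(1) by (intro exI[of _ ?c]) (simp add: add_nonpos_neg mult_neg_pos)
qed

lemma integral_inverse_sqrt:
  assumes "mu \<ge> 0" "D > 0"
  shows "((\<lambda>xi. 1 / sqrt (xi\<^sup>2 + D\<^sup>2)) has_integral ln ((mu + sqrt (mu\<^sup>2 + D\<^sup>2)) / D)) {0..mu}"
proof -
  have "((\<lambda>xi. 1 / sqrt (xi\<^sup>2 + D\<^sup>2)) has_integral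
      ln (mu + sqrt (mu\<^sup>2 + D\<^sup>2)) - ln (0 + sqrt (0\<^sup>2 + D\<^sup>2))) {0..mu}"
    using assms DERIV_ln_add_sqrt[OF assms(2)]
    by (intro fundamental_theorem_of_calculus)
       (auto simp: has_real_derivative_iff_has_vector_derivative[symmetric] intro: DERIV_subset)
  then show ?thesis using assms add_sqrt_pos[OF assms(2), of mu] by (simp add: ln_div)
qed

section \<open>Comparison of positive and zero temperature\<close>

lemma ln_cosh_diff_le:
  assumes "x \<le> (y::real)" shows "ln (cosh y) - ln (cosh x) \<le> y - x"
proof -
  have "x - ln (cosh x) \<le> y - ln (cosh y)"
    using assms
  proof (rule DERIV_nonneg_imp_nondecreasing)
    fix z
    show "\<exists>d. ((\<lambda>x. x - ln (cosh x)) has_real_derivative d) (at z) \<and> d \<ge> 0"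
      using DERIV_diff[OF DERIV_ident DERIV_ln_cosh, of z] tanh_real_lt_1[of z] by (intro exI[of _ "1 - tanh z"]) auto
  qed
  then show ?thesis by simp
qed

text \<open>From \<open>cosh y \<ge> exp y / 2\<close> and \<open>ln (cosh x) \<le> x\<close>. The
  loss \<open>ln 2\<close> does not depend on the arguments, so after division by \<open>b\<close>
  it vanishes in the zero-temperature limit.\<close>

lemma ln_cosh_diff_ge:
  assumes "0 \<le> (x::real)" shows "y - x - ln 2 \<le> ln (cosh y) - ln (cosh x)"
proof -
  have "ln (exp y / 2) \<le> ln (cosh y)"
    by (subst ln_le_cancel_iff) (auto simp: cosh_def intro: add_pos_pos)
  moreover have "ln (cosh x) \<le> x" using ln_cosh_diff_le[OF assms] by simp
  ultimately show ?thesis by (simp add: ln_div)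
qed

text \<open>Both parts grow when \<open>tanh\<close> is replaced by 1; strictness comes from the
  integral.\<close>

lemma gap_fun_less_gap0_fun:
  assumes "0 < mu" "mu \<le> xm" "b > 0" "D > 0"
  shows "gap_fun xm mu b D < gap0_fun xm mu D"
proof -
  let ?E = "\<lambda>x. sqrt (x\<^sup>2 + D\<^sup>2)"
  have E: "?E x > 0" for x using assms by (simp add: add_nonneg_pos)
  have h: "ln (cosh (b * ?E xm)) - ln (cosh (b * ?E mu)) \<le> b * ?E xm - b * ?E mu"
    using assms by (intro ln_cosh_diff_le) auto
  have 1: "(ln (cosh (b * ?E xm)) - ln (cosh (b * ?E mu))) / b \<le> ?E xm - ?E mu"
    using divide_right_mono[OF h, of b] assms(3) by (simp add: diff_divide_distrib)
  have "gap_int mu b D < integral {0..mu} (\<lambda>xi. 1 / ?E xi)"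
    unfolding gap_int_def
  proof (rule integral_less_real)
    show "continuous_on {0..mu} (\<lambda>xi. 1 / ?E xi)"
      using E by (intro continuous_intros) (auto simp: less_imp_neq[symmetric])
    fix xi
    have "b * tanhc (b * ?E xi) = tanh (b * ?E xi) / ?E xi"
      using E[of xi] assms by (simp add: tanhc_def)
    also have "\<dots> < 1 / ?E xi"
      using E[of xi] tanh_real_lt_1 by (intro divide_strict_right_mono) auto
    finally show "b * tanhc (b * ?E xi) < 1 / ?E xi" .
  qed (use assms in \<open>auto intro!: continuous_intros\<close>)
  also have "\<dots> = ln ((mu + ?E mu) / D)"
    using integral_inverse_sqrt[of mu D] assms by (simp add: integral_unique)
  finally have "mu * gap_int mu b D < mu * ln ((mu + ?E mu) / D)" using assms(1) by simp
  with 1 show ?thesis unfolding gap_fun_def gap0_fun_def by simp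
qed

text \<open>Since \<open>E \<ge> D\<close> for every \<open>xi\<close>, the factor
  \<open>tanh (b * E)\<close> is at least the constant \<open>tanh (b * D)\<close>, which leaves the
  integral. With the upper bound this gives the zero-temperature limit by squeezing, without a
  convergence theorem for integrals.\<close>

lemma gap_fun_ge:
  assumes "0 < mu" "mu \<le> xm" "b > 0" "D > 0"
  shows "sqrt (xm\<^sup>2 + D\<^sup>2) - sqrt (mu\<^sup>2 + D\<^sup>2) - ln 2 / b
    + mu * (tanh (b * D) * ln ((mu + sqrt (mu\<^sup>2 + D\<^sup>2)) / D)) \<le> gap_fun xm mu b D"
proof -
  let ?E = "\<lambda>x. sqrt (x\<^sup>2 + D\<^sup>2)"
  have E: "?E x > 0" for x using assms by (simp add: add_nonneg_pos)
  have h: "b * ?E xm - b * ?E mu - ln 2 \<le> ln (cosh (b * ?E xm)) - ln (cosh (b * ?E mu))"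
    using assms E by (intro ln_cosh_diff_ge) auto
  have 1: "?E xm - ?E mu - ln 2 / b \<le> (ln (cosh (b * ?E xm)) - ln (cosh (b * ?E mu))) / b"
    using divide_right_mono[OF h, of b] assms(3) by (simp add: diff_divide_distrib)
  have "tanh (b * D) * ln ((mu + ?E mu) / D) = integral {0..mu} (\<lambda>xi. tanh (b * D) * (1 / ?E xi))"
    using integral_inverse_sqrt[of mu D] assms by (simp only: integral_mult_right) (simp add: integral_unique)
  also have "\<dots> \<le> gap_int mu b D"
    unfolding gap_int_def
  proof (rule integral_le)
    show "(\<lambda>xi. tanh (b * D) * (1 / ?E xi)) integrable_on {0..mu}"
      using E by (intro integrable_continuous_interval continuous_intros) (auto simp: less_imp_neq[symmetric])
    show "(\<lambda>xi. b * tanhc (b * ?E xi)) integrable_on {0..mu}"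
      by (intro integrable_continuous_interval continuous_intros)
    fix xi
    have "sqrt (D\<^sup>2) \<le> ?E xi" by (intro real_sqrt_le_mono) simp
    then have "tanh (b * D) \<le> tanh (b * ?E xi)" using assms by simp
    then have "tanh (b * D) * (1 / ?E xi) \<le> tanh (b * ?E xi) / ?E xi"
      using E[of xi] by (simp add: divide_right_mono)
    also have "\<dots> = b * tanhc (b * ?E xi)" using E[of xi] assms by (simp add: tanhc_def)
    finally show "tanh (b * D) * (1 / ?E xi) \<le> b * tanhc (b * ?E xi)" .
  qed
  finally have "mu * (tanh (b * D) * ln ((mu + ?E mu) / D)) \<le> mu * gap_int mu b D"
    using assms(1) by (intro mult_left_mono) auto
  with 1 show ?thesis unfolding gap_fun_def by simp
qed

lemma tendsto_gap_fun:
  assumes "0 < mu" "mu \<le> xm" "D > 0"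
  shows "((\<lambda>T. gap_fun xm mu (1 / (2 * T)) D) \<longlongrightarrow> gap0_fun xm mu D) (at_right 0)"
proof (rule tendsto_sandwich)
  let ?A = "ln ((mu + sqrt (mu\<^sup>2 + D\<^sup>2)) / D)"
  let ?d = "sqrt (xm\<^sup>2 + D\<^sup>2) - sqrt (mu\<^sup>2 + D\<^sup>2)"
  have ev: "eventually (\<lambda>T::real. T > 0) (at_right 0)" by (simp add: eventually_at_right_less)
  show "eventually (\<lambda>T. gap_fun xm mu (1 / (2 * T)) D \<le> gap0_fun xm mu D) (at_right 0)"
    using ev by eventually_elim (rule less_imp_le, rule gap_fun_less_gap0_fun, use assms in auto)
  show "eventually (\<lambda>T. ?d - ln 2 * (2 * T) + mu * (tanh (D / 2 * inverse T) * ?A) \<le> gap_fun xm mu (1 / (2 * T)) D) (at_right 0)"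
    using ev
  proof eventually_elim
    case (elim T)
    then show ?case using gap_fun_ge[of mu xm "1 / (2 * T)" D] assms by (simp add: field_simps)
  qed
  have "filterlim (\<lambda>T. D / 2 * inverse T) at_top (at_right (0::real))"
    using assms(3) by (intro filterlim_tendsto_pos_mult_at_top[OF tendsto_const] filterlim_inverse_at_top_right) auto
  from filterlim_compose[OF tanh_real_at_top this]
  have t: "((\<lambda>T. tanh (D / 2 * inverse T)) \<longlongrightarrow> 1) (at_right 0)" .
  have "((\<lambda>T. ?d - ln 2 * (2 * T) + mu * (tanh (D / 2 * inverse T) * ?A)) \<longlongrightarrow> ?d - ln 2 * (2 * 0) + mu * (1 * ?A)) (at_right 0)"
    by (intro tendsto_intros t)
  then show "((\<lambda>T. ?d - ln 2 * (2 * T) + mu * (tanh (D / 2 * inverse T) * ?A)) \<longlongrightarrow> gap0_fun xm mu D) (at_right 0)"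
    unfolding gap0_fun_def by simp
qed simp

section \<open>Behaviour for extreme values of the unknown\<close>

lemma gap0_fun_large:
  assumes "0 < mu" "mu \<le> xm" "c > 0"
  shows "\<exists>D>0. gap0_fun xm mu D < c"
proof -
  \<comment> \<open>The estimates \<open>E \<le> D + x\<^sup>2 / D\<close> and
    \<open>ln t \<le> t - 1\<close> bound the function by \<open>K / D\<close>; the choice of
    \<open>D\<close> makes this \<open>c / 2\<close>.\<close>
  define K where "K = xm\<^sup>2 + 2 * mu\<^sup>2"
  have K: "K > 0" using assms unfolding K_def by (intro add_pos_pos) auto
  define D where "D = 2 * K / c"
  have D: "D > 0" unfolding D_def using K assms by simp
  let ?E = "\<lambda>x. sqrt (x\<^sup>2 + D\<^sup>2)"
  have sq: "?E x \<le> D + x\<^sup>2 / D" for x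
  proof (rule real_le_lsqrt)
    show "0 \<le> D + x\<^sup>2 / D" using D by (simp add: add_nonneg_nonneg)
    have "(D + x\<^sup>2 / D)\<^sup>2 = D\<^sup>2 + 2 * x\<^sup>2 + (x\<^sup>2 / D)\<^sup>2" using D by (simp add: power2_sum)
    then show "x\<^sup>2 + D\<^sup>2 \<le> (D + x\<^sup>2 / D)\<^sup>2" by simp
  qed
  have lower: "D \<le> ?E mu" using D by (simp add: real_le_rsqrt)
  have h: "?E mu \<le> mu + D" using sqrt_add_le_add_sqrt[of "mu\<^sup>2" "D\<^sup>2"] assms D by simp
  have "(mu + ?E mu) / D - 1 \<le> 2 * mu / D"
    using D divide_right_mono[OF h, of D] by (simp add: add_divide_distrib)
  moreover have "ln ((mu + ?E mu) / D) \<le> (mu + ?E mu) / D - 1"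
    using D add_sqrt_pos[OF D, of mu] by (intro ln_le_minus_one divide_pos_pos)
  ultimately have "mu * ln ((mu + ?E mu) / D) \<le> mu * (2 * mu / D)"
    using assms(1) by (intro mult_left_mono) auto
  then have "gap0_fun xm mu D \<le> xm\<^sup>2 / D + mu * (2 * mu / D)"
    unfolding gap0_fun_def using sq[of xm] lower by linarith
  also have "\<dots> = K / D" unfolding K_def by (simp add: add_divide_distrib power2_eq_square)
  also have "\<dots> = c / 2" unfolding D_def using K assms(3) by (simp add: field_simps)
  also have "\<dots> < c" using assms(3) by simp
  finally show ?thesis using D by blast
qed

lemma gap0_fun_small:
  assumes "0 < mu" "mu \<le> xm"
  shows "\<exists>D>0. gap0_fun xm mu D > c"
proof -
  \<comment> \<open>Chosen so that \<open>mu * ln (mu / D)\<close>, a lower bound for the whole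
    function, equals \<open>\<bar>c\<bar> + 1\<close>.\<close>
  define D where "D = mu * exp (- (\<bar>c\<bar> + 1) / mu)"
  have D: "D > 0" unfolding D_def using assms by simp
  let ?E = "\<lambda>x. sqrt (x\<^sup>2 + D\<^sup>2)"
  have "c < \<bar>c\<bar> + 1" by simp
  also have "\<dots> = mu * ln (mu / D)"
    unfolding D_def using assms by (simp add: ln_div)
  also have "\<dots> \<le> mu * ln ((mu + ?E mu) / D)"
    using assms D by (intro mult_left_mono, subst ln_le_cancel_iff)
      (auto simp: divide_right_mono intro!: add_pos_nonneg divide_pos_pos)
  also have "\<dots> \<le> gap0_fun xm mu D"
    unfolding gap0_fun_def using assms by simp
  finally show ?thesis using D by blast
qed

lemma gap_fun_0_small:
  assumes "0 < mu" "mu \<le> xm" "c > 0"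
  shows "\<exists>b>0. gap_fun xm mu b 0 < c"
proof -
  \<comment> \<open>From \<open>ln (cosh x) \<le> x\<^sup>2\<close> and
    \<open>tanhc x \<le> 1\<close> the value is at most \<open>b * K\<close>, which the choice of
    \<open>b\<close> makes \<open>c / 2\<close>.\<close>
  define K where "K = xm\<^sup>2 + mu\<^sup>2"
  have K: "K > 0" using assms unfolding K_def by (intro add_pos_pos) auto
  define b where "b = c / (2 * K)"
  have b: "b > 0" unfolding b_def using K assms by simp
  have "ln (cosh (b * xm)) \<le> b\<^sup>2 * xm\<^sup>2"
  proof -
    have "0\<^sup>2 - ln (cosh (0::real)) \<le> (b * xm)\<^sup>2 - ln (cosh (b * xm))"
    proof (rule DERIV_nonneg_imp_nondecreasing[where f="\<lambda>x. x\<^sup>2 - ln (cosh x)"])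
      fix z :: real assume "0 \<le> z"
      show "\<exists>d. ((\<lambda>x. x\<^sup>2 - ln (cosh x)) has_real_derivative d) (at z) \<and> d \<ge> 0"
      proof (intro exI conjI)
        show "((\<lambda>x. x\<^sup>2 - ln (cosh x)) has_real_derivative 2 * z - tanh z) (at z)"
          by (intro DERIV_diff DERIV_ln_cosh) (auto intro!: derivative_eq_intros)
        show "0 \<le> 2 * z - tanh z" using tanh_le_self[OF \<open>0 \<le> z\<close>] \<open>0 \<le> z\<close> by simp
      qed
    qed (use b assms in simp)
    then show ?thesis by (simp add: power_mult_distrib)
  qed
  moreover have "ln (cosh (b * mu)) \<ge> 0" using cosh_real_ge_1 by (simp add: ln_ge_zero)
  ultimately have "ln (cosh (b * xm)) - ln (cosh (b * mu)) \<le> b\<^sup>2 * xm\<^sup>2" by linarith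
  then have "(ln (cosh (b * xm)) - ln (cosh (b * mu))) / b \<le> b * xm\<^sup>2"
    using b by (simp add: pos_divide_le_eq power2_eq_square mult_ac)
  moreover have "mu * gap_int mu b 0 \<le> b * mu\<^sup>2"
  proof -
    have "gap_int mu b 0 \<le> integral {0..mu} (\<lambda>_. b)"
      unfolding gap_int_def using b tanhc_le_1
      by (intro integral_le integrable_continuous_interval continuous_intros) (auto intro!: mult_left_le)
    then have "gap_int mu b 0 \<le> mu * b" using assms by simp
    then have "mu * gap_int mu b 0 \<le> mu * (mu * b)" using assms by (intro mult_left_mono) auto
    then show ?thesis by (simp add: power2_eq_square algebra_simps)
  qed
  ultimately have "gap_fun xm mu b 0 \<le> b * K"
    unfolding gap_fun_def K_def using assms by (simp add: algebra_simps)
  also have "\<dots> = c / 2" unfolding b_def using K by simp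
  also have "\<dots> < c" using assms(3) by simp
  finally show ?thesis using b by blast
qed

text \<open>For \<open>z \<ge> 1\<close> the integrand is at least \<open>tanh 1 / z\<close>. This
  logarithmic growth is what yields a critical temperature for every \<open>lam > 0\<close>.\<close>

lemma tanhc_int_ge:
  assumes "u \<ge> 1" shows "tanhc_int u \<ge> tanh 1 * ln u"
proof -
  have "tanhc_int 1 - tanh 1 * ln 1 \<le> tanhc_int u - tanh 1 * ln u"
    using assms
  proof (rule DERIV_nonneg_imp_nondecreasing)
    fix z :: real assume z: "1 \<le> z"
    show "\<exists>d. ((\<lambda>u. tanhc_int u - tanh 1 * ln u) has_real_derivative d) (at z) \<and> d \<ge> 0"
    proof (intro exI conjI)
      show "((\<lambda>u. tanhc_int u - tanh 1 * ln u) has_real_derivative tanhc z - tanh 1 * inverse z) (at z)"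
        using z by (intro DERIV_diff DERIV_tanhc_int DERIV_cmult DERIV_ln) auto
      show "0 \<le> tanhc z - tanh 1 * inverse z"
        using z by (simp add: tanhc_def field_simps)
    qed
  qed
  moreover have "tanhc_int 1 \<ge> 0"
    unfolding tanhc_int_def using tanhc_pos less_imp_le
    by (intro integral_nonneg integrable_continuous_interval continuous_intros) blast
  ultimately show ?thesis by simp
qed

lemma gap_fun_0_large:
  assumes "0 < mu" "mu \<le> xm"
  shows "\<exists>b>0. gap_fun xm mu b 0 > c"
proof -
  \<comment> \<open>Chosen so that \<open>mu * tanh 1 * ln u\<close> equals
    \<open>\<bar>c\<bar> + 1\<close>.\<close>
  define u :: real where "u = exp ((\<bar>c\<bar> + 1) / (mu * tanh 1))"
  have t: "mu * tanh 1 > 0" using assms by simp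
  have u: "u \<ge> 1" unfolding u_def using t by (simp add: divide_nonneg_pos)
  define b where "b = u / mu"
  have b: "b > 0" "b * mu = u" unfolding b_def using u assms by auto
  have "c < \<bar>c\<bar> + 1" by simp
  also have "\<dots> = mu * tanh 1 * ln u"
    unfolding u_def ln_exp times_divide_eq_right nonzero_mult_div_cancel_left[OF less_imp_neq[OF t, symmetric]] ..
  also have "\<dots> \<le> mu * gap_int mu b 0"
    unfolding gap_int_0[OF assms(1) b(1)] b(2) mult.assoc using tanhc_int_ge[OF u] assms by simp
  also have "\<dots> \<le> gap_fun xm mu b 0"
  proof -
    have "ln (cosh (b * sqrt (xm\<^sup>2 + 0\<^sup>2))) \<ge> ln (cosh (b * sqrt (mu\<^sup>2 + 0\<^sup>2)))"
      using assms b(1) mult_left_mono[OF assms(2), of b] by (simp add: cosh_real_nonneg_le_iff)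
    then show ?thesis unfolding gap_fun_def using b(1) by simp
  qed
  finally show ?thesis using b(1) by blast
qed

subsection \<open>Critical temperature and gap as implicit functions\<close>

lemma DERIV_gap_fun_T:
  assumes "0 < mu" "mu \<le> xm" "T > 0"
  shows "\<exists>c<0. ((\<lambda>T. gap_fun xm mu (1 / (2 * T)) D) has_real_derivative c) (at T)"
proof -
  obtain c where c: "c > 0" "((\<lambda>b. gap_fun xm mu b D) has_real_derivative c) (at (1 / (2 * T)))"
    using DERIV_gap_fun_b[of mu xm "1 / (2 * T)" D] assms by auto
  have "((\<lambda>T. 1 / (2 * T)) has_real_derivative - 1 / (2 * T\<^sup>2)) (at T)"
    using assms by (auto intro!: derivative_eq_intros simp: field_simps power2_eq_square)
  from DERIV_chain2[OF c(2) this]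
  have "((\<lambda>T. gap_fun xm mu (1 / (2 * T)) D) has_real_derivative c * (- 1 / (2 * T\<^sup>2))) (at T)" .
  moreover have "c * (- 1 / (2 * T\<^sup>2)) < 0" using c(1) assms by (simp add: mult_pos_neg)
  ultimately show ?thesis by blast
qed

text \<open>The derivative in \<open>D\<close> was computed for \<open>D > 0\<close> only;
  continuity of the gap function carries strict decrease to the end point 0.\<close>

lemma gap_fun_less_gap_fun_0:
  assumes "0 < mu" "mu \<le> xm" "b > 0" "D > 0"
  shows "gap_fun xm mu b D < gap_fun xm mu b 0"
  using assms(4)
proof (rule DERIV_neg_imp_decreasing_open)
  show "\<exists>y. (gap_fun xm mu b has_real_derivative y) (at x) \<and> y < 0" if "0 < x" for x
    using DERIV_gap_fun_D[of mu xm b x] assms that by auto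
  show "continuous_on {0..D} (gap_fun xm mu b)"
    using assms by (intro continuous_on_gap_fun) auto
qed

text \<open>The left end point may be 0, reached by continuity, so that a gap can be compared with
  the explicit solution for \<open>mu = 0\<close>.\<close>

lemma gap0_fun_strict_mono:
  assumes "0 \<le> m" "m < m'" "D > 0"
  shows "gap0_fun xm m D < gap0_fun xm m' D"
  using assms(2)
proof (rule DERIV_pos_imp_increasing_open)
  show "\<exists>y. ((\<lambda>m. gap0_fun xm m D) has_real_derivative y) (at x) \<and> y > 0" if "m < x" for x
    using DERIV_gap0_fun_mu[of x D xm] assms that by auto
  have "(x + sqrt (x\<^sup>2 + D\<^sup>2)) / D \<noteq> 0" for x
    using add_sqrt_pos[OF assms(3), of x] assms(3) by simp
  then show "continuous_on {m..m'} (\<lambda>m. gap0_fun xm m D)"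
    unfolding gap0_fun_def using assms(3) by (intro continuous_intros) auto
qed

text \<open>Squaring \<open>sqrt (xm\<^sup>2 + D\<^sup>2) = xm / lam + D\<close> cancels
  \<open>D\<^sup>2\<close>, leaving an equation linear in \<open>D\<close>. Its solution is positive
  only for \<open>lam > 1\<close>.\<close>

lemma zeroT_eq_mu_0_iff:
  assumes "xm > 0" "lam > 0" "D > 0"
  shows "zeroT_eq xm 0 lam D \<longleftrightarrow> lam > 1 \<and> D = xm / 2 * (lam - 1 / lam)"
proof -
  have "zeroT_eq xm 0 lam D \<longleftrightarrow> sqrt (xm\<^sup>2 + D\<^sup>2) = xm / lam + D"
    unfolding zeroT_eq_def using assms by auto
  also have "\<dots> \<longleftrightarrow> xm\<^sup>2 + D\<^sup>2 = (xm / lam + D)\<^sup>2"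
  proof
    assume "sqrt (xm\<^sup>2 + D\<^sup>2) = xm / lam + D"
    then have "(sqrt (xm\<^sup>2 + D\<^sup>2))\<^sup>2 = (xm / lam + D)\<^sup>2" by simp
    then show "xm\<^sup>2 + D\<^sup>2 = (xm / lam + D)\<^sup>2" by simp
  next
    assume "xm\<^sup>2 + D\<^sup>2 = (xm / lam + D)\<^sup>2"
    moreover have "xm / lam + D \<ge> 0" using assms by simp
    ultimately show "sqrt (xm\<^sup>2 + D\<^sup>2) = xm / lam + D" by simp
  qed
  also have "\<dots> \<longleftrightarrow> xm * xm = (xm / lam) * (xm / lam + 2 * D)"
    by (auto simp: power2_eq_square algebra_simps)
  also have "\<dots> \<longleftrightarrow> xm = (xm / lam + 2 * D) / lam"
    using assms(1) mult_left_cancel[of xm xm "(xm / lam + 2 * D) / lam"] by simp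
  also have "\<dots> \<longleftrightarrow> D = xm / 2 * (lam - 1 / lam)"
    using assms by (auto simp: field_simps)
  also have "\<dots> \<longleftrightarrow> lam > 1 \<and> D = xm / 2 * (lam - 1 / lam)"
  proof -
    have "lam > 1" if "D = xm / 2 * (lam - 1 / lam)"
    proof -
      have "0 < xm / 2 * (lam - 1 / lam)" using that assms(3) by simp
      then have "1 / lam < lam" using assms(1) by (simp add: zero_less_mult_iff)
      then have "1 < lam * lam" using assms(2) by (simp add: divide_less_eq)
      then show ?thesis using assms(2) mult_le_one[of lam lam] by (meson less_eq_real_def not_le)
    qed
    then show ?thesis by blast
  qed
  finally show ?thesis .
qed

text \<open>For \<open>mu = xm\<close> the square roots outside the logarithm cancel and the
  equation says \<open>arsinh (xm / D) = 1 / lam\<close>.\<close>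

lemma zeroT_eq_mu_xm:
  assumes "xm > 0" "lam > 0"
  shows "zeroT_eq xm xm lam (xm / sinh (1 / lam))"
proof -
  define s where "s = sinh (1 / lam)"
  have s: "s > 0" unfolding s_def using assms by simp
  have "xm\<^sup>2 + (xm / s)\<^sup>2 = (xm / s * cosh (1 / lam))\<^sup>2"
    using s cosh_square_eq[of "1 / lam"] unfolding s_def[symmetric]
    by (simp add: power_mult_distrib power_divide field_simps)
  then have "sqrt (xm\<^sup>2 + (xm / s)\<^sup>2) = xm / s * cosh (1 / lam)"
    using s assms by (simp add: real_sqrt_unique)
  then have "(xm + sqrt (xm\<^sup>2 + (xm / s)\<^sup>2)) / (xm / s) = s + cosh (1 / lam)"
    using s assms by (simp add: field_simps)
  also have "\<dots> = exp (1 / lam)" unfolding s_def by (rule sinh_plus_cosh)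
  finally show ?thesis unfolding zeroT_eq_def s_def[symmetric] by simp
qed

text \<open>The slope of \<open>ln (cosh x)\<close> is below 1, so a positive solution gives
  \<open>xm / lam \<le> sqrt (xm\<^sup>2 + D\<^sup>2) - D < xm\<close>.\<close>

lemma gap_eq_mu_0:
  assumes "xm > 0" "lam > 0" "T > 0" "D > 0" "gap_eq xm 0 lam T D"
  shows "lam > 1"
proof -
  let ?b = "1 / (2 * T)"
  have "xm / lam = (ln (cosh (?b * sqrt (xm\<^sup>2 + D\<^sup>2))) - ln (cosh (?b * D))) / ?b"
    using assms unfolding gap_eq_iff[OF assms(3)] gap_fun_def by auto
  also have "\<dots> \<le> (?b * sqrt (xm\<^sup>2 + D\<^sup>2) - ?b * D) / ?b"
    using assms by (intro divide_right_mono ln_cosh_diff_le mult_left_mono real_le_rsqrt) auto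
  also have "\<dots> = sqrt (xm\<^sup>2 + D\<^sup>2) - D"
    using assms(3) by (simp flip: diff_divide_distrib)
  also have "\<dots> < xm"
  proof -
    have "xm\<^sup>2 + D\<^sup>2 < (xm + D)\<^sup>2" using assms by (simp add: power2_sum)
    then have "sqrt (xm\<^sup>2 + D\<^sup>2) < xm + D" using assms by (intro real_less_lsqrt) auto
    then show ?thesis by simp
  qed
  finally show ?thesis using assms by (simp add: divide_less_eq)
qed

lemma has_vector_derivative_Pair1:
  "((\<lambda>x. (x, c)) has_vector_derivative (1, 0)) (at (x::real))"
  by (auto simp: has_vector_derivative_def intro!: derivative_eq_intros)

lemma has_vector_derivative_Pair2:
  assumes "(f has_vector_derivative f') (at (x::real))"
  shows "((\<lambda>x. (c, f x)) has_vector_derivative (0, f')) (at x)"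
  using assms by (auto simp: has_vector_derivative_def intro!: derivative_eq_intros)

section \<open>The three root functions for a fixed truncation energy\<close>

locale gap_model =
  fixes xm :: real
  assumes xm_pos: "xm > 0"
begin

definition params :: "(real \<times> real) set" where
  "params = {(mu, lam). 0 < mu \<and> mu \<le> xm \<and> 0 < lam}"

lemma DERIV_minus_coupling:
  "lam > 0 \<Longrightarrow> \<exists>a>0. ((\<lambda>l. c - xm / l) has_real_derivative a) (at lam)"
  using xm_pos by (intro exI[of _ "xm / lam\<^sup>2"])
    (auto intro!: derivative_eq_intros simp: power2_eq_square)

text \<open>The unknown is the temperature, with \<open>D = 0\<close> inserted. Signs are exhibited
  in terms of \<open>b\<close> and translated by \<open>y = 1 / (2 * b)\<close>: the positive value
  arises at low temperature, the negative one at high temperature.\<close>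

sublocale Tc: decreasing_equation
  "\<lambda>z. gap_fun xm (fst (fst z)) (1 / (2 * snd z)) 0 - xm / snd (fst z)" "{0<..} \<times> {0<..}" params
proof
  show "open ({0::real<..} \<times> {0::real<..})" by (intro open_Times) auto
  show "params \<subseteq> {0<..} \<times> {0<..}" unfolding params_def by auto
next
  fix k
  let ?W = "({0::real<..} \<times> {0::real<..}) \<times> {0::real<..}"
  have m: "diffk_on k ?W (\<lambda>z. fst (fst z))"
    by (intro diffk_on_linear bounded_linear_fst_comp bounded_linear_fst)
  have l: "diffk_on k ?W (\<lambda>z. snd (fst z))"
    by (intro diffk_on_linear bounded_linear_snd_comp bounded_linear_fst)
  have T: "diffk_on k ?W (\<lambda>z. 1 / (2 * snd z))"
    by (intro diffk_on_divide diffk_on_mult diffk_on_const diffk_on_linear bounded_linear_snd) auto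
  show "diffk_on k ?W (\<lambda>z. gap_fun xm (fst (fst z)) (1 / (2 * snd z)) 0 - xm / snd (fst z))"
    by (intro diffk_on_diff diffk_on_divide diffk_on_const l diffk_on_gap_fun diffk_on_gap_int_0 m T)
       (use xm_pos in auto)
next
  fix p y assume "p \<in> params" and y: "(0::real) < y"
  then obtain mu lam where p: "p = (mu, lam)" "0 < mu" "mu \<le> xm" "0 < lam" unfolding params_def by auto
  obtain c where "c < 0" "((\<lambda>T. gap_fun xm mu (1 / (2 * T)) 0) has_real_derivative c) (at y)"
    using DERIV_gap_fun_T[OF p(2,3) y] by blast
  then show "\<exists>c<0. ((\<lambda>y. gap_fun xm (fst (fst (p, y))) (1 / (2 * snd (p, y))) 0 - xm / snd (fst (p, y)))
      has_real_derivative c) (at y)"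
    using p(1) DERIV_diff[OF _ DERIV_const] by (intro exI[of _ c]) fastforce
next
  fix p assume "p \<in> params"
  then obtain mu lam where p: "p = (mu, lam)" "0 < mu" "mu \<le> xm" "0 < lam" unfolding params_def by auto
  obtain b where "b > 0" "gap_fun xm mu b 0 > xm / lam" using gap_fun_0_large[OF p(2,3)] by blast
  then show "\<exists>y>0. 0 < gap_fun xm (fst (fst (p, y))) (1 / (2 * snd (p, y))) 0 - xm / snd (fst (p, y))"
    unfolding p(1) by (intro exI[of _ "1 / (2 * b)"]) simp
  have "xm / lam > 0" using xm_pos p(4) by simp
  then obtain b where "b > 0" "gap_fun xm mu b 0 < xm / lam"
    using gap_fun_0_small[OF p(2,3)] by blast
  then show "\<exists>y>0. gap_fun xm (fst (fst (p, y))) (1 / (2 * snd (p, y))) 0 - xm / snd (fst (p, y)) < 0"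
    unfolding p(1) by (intro exI[of _ "1 / (2 * b)"]) simp
qed

sublocale Gap0: decreasing_equation
  "\<lambda>z. gap0_fun xm (fst (fst z)) (snd z) - xm / snd (fst z)" "{0<..} \<times> {0<..}" params
proof
  show "open ({0::real<..} \<times> {0::real<..})" by (intro open_Times) auto
  show "params \<subseteq> {0<..} \<times> {0<..}" unfolding params_def by auto
next
  fix k
  let ?W = "({0::real<..} \<times> {0::real<..}) \<times> {0::real<..}"
  have m: "diffk_on k ?W (\<lambda>z. fst (fst z))"
    by (intro diffk_on_linear bounded_linear_fst_comp bounded_linear_fst)
  have l: "diffk_on k ?W (\<lambda>z. snd (fst z))"
    by (intro diffk_on_linear bounded_linear_snd_comp bounded_linear_fst)
  have d: "diffk_on k ?W snd"
    by (intro diffk_on_linear bounded_linear_snd)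
  show "diffk_on k ?W (\<lambda>z. gap0_fun xm (fst (fst z)) (snd z) - xm / snd (fst z))"
    by (intro diffk_on_diff diffk_on_divide diffk_on_const l diffk_on_gap0_fun m d)
       (use xm_pos in auto)
next
  fix p y assume "p \<in> params" and y: "(0::real) < y"
  then obtain mu lam where p: "p = (mu, lam)" "0 < mu" "mu \<le> xm" "0 < lam" unfolding params_def by auto
  obtain c where "c < 0" "((\<lambda>D. gap0_fun xm mu D) has_real_derivative c) (at y)"
    using DERIV_gap0_fun_D[OF p(2,3) y] by blast
  then show "\<exists>c<0. ((\<lambda>y. gap0_fun xm (fst (fst (p, y))) (snd (p, y)) - xm / snd (fst (p, y)))
      has_real_derivative c) (at y)"
    using p(1) DERIV_diff[OF _ DERIV_const] by (intro exI[of _ c]) fastforce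
next
  fix p assume "p \<in> params"
  then obtain mu lam where p: "p = (mu, lam)" "0 < mu" "mu \<le> xm" "0 < lam" unfolding params_def by auto
  show "\<exists>y>0. 0 < gap0_fun xm (fst (fst (p, y))) (snd (p, y)) - xm / snd (fst (p, y))"
    using gap0_fun_small[OF p(2,3), of "xm / lam"] unfolding p(1) by simp
  have "xm / lam > 0" using xm_pos p(4) by simp
  then show "\<exists>y>0. gap0_fun xm (fst (fst (p, y))) (snd (p, y)) - xm / snd (fst (p, y)) < 0"
    using gap0_fun_large[OF p(2,3), of "xm / lam"] unfolding p(1) by simp
qed

definition Tc :: "real \<Rightarrow> real \<Rightarrow> real" where "Tc mu lam = Tc.root (mu, lam)"

definition params3 :: "(real \<times> real \<times> real) set" where
  "params3 = {(mu, T, lam). 0 < mu \<and> mu \<le> xm \<and> 0 < lam \<and> 0 < T \<and> T < Tc mu lam}"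

lemma paramsI: "0 < mu \<Longrightarrow> mu \<le> xm \<Longrightarrow> 0 < lam \<Longrightarrow> (mu, lam) \<in> params"
  unfolding params_def by simp

lemma less_Tc_iff:
  assumes "0 < mu" "mu \<le> xm" "0 < lam" "0 < T"
  shows "T < Tc mu lam \<longleftrightarrow> gap_fun xm mu (1 / (2 * T)) 0 > xm / lam"
  using Tc.less_root_iff[OF paramsI[OF assms(1-3)] assms(4)] unfolding Tc_def by simp

lemma Tc_pos: "0 < mu \<Longrightarrow> mu \<le> xm \<Longrightarrow> 0 < lam \<Longrightarrow> Tc mu lam > 0"
  unfolding Tc_def by (intro Tc.root_pos paramsI)

lemma gap_fun_Tc:
  "0 < mu \<Longrightarrow> mu \<le> xm \<Longrightarrow> 0 < lam \<Longrightarrow> gap_fun xm mu (1 / (2 * Tc mu lam)) 0 = xm / lam"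
  using Tc.root_zero[OF paramsI, of mu lam] unfolding Tc_def by simp

lemma Tc_unique:
  "0 < mu \<Longrightarrow> mu \<le> xm \<Longrightarrow> 0 < lam \<Longrightarrow> 0 < T \<Longrightarrow> gap_fun xm mu (1 / (2 * T)) 0 = xm / lam \<Longrightarrow> T = Tc mu lam"
  using Tc.root_unique[OF paramsI, of mu lam T] unfolding Tc_def by simp

text \<open>The parameter set involves \<open>Tc\<close>, so this instance comes after it. Below
  \<open>Tc\<close> the gap function at \<open>D = 0\<close> exceeds \<open>xm / lam\<close>, and
  continuity preserves this for small \<open>D > 0\<close>. For the negative value, the
  zero-temperature function is a majorant that falls below \<open>xm / lam\<close>.\<close>

sublocale Gap: decreasing_equation
  "\<lambda>z. gap_fun xm (fst (fst z)) (1 / (2 * fst (snd (fst z)))) (snd z) - xm / snd (snd (fst z))"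
  "{0<..} \<times> {0<..} \<times> {0<..}" params3
proof
  show "open ({0::real<..} \<times> {0::real<..} \<times> {0::real<..})" by (intro open_Times) auto
  show "params3 \<subseteq> {0<..} \<times> {0<..} \<times> {0<..}" unfolding params3_def by auto
next
  fix k
  let ?W = "({0::real<..} \<times> {0::real<..} \<times> {0::real<..}) \<times> {0::real<..}"
  have m: "diffk_on k ?W (\<lambda>z. fst (fst z))"
    by (intro diffk_on_linear bounded_linear_fst_comp bounded_linear_fst)
  have T: "diffk_on k ?W (\<lambda>z. fst (snd (fst z)))"
    by (intro diffk_on_linear bounded_linear_fst_comp bounded_linear_snd_comp bounded_linear_fst)
  have l: "diffk_on k ?W (\<lambda>z. snd (snd (fst z)))"
    by (intro diffk_on_linear bounded_linear_snd_comp bounded_linear_fst)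
  have d: "diffk_on k ?W snd"
    by (intro diffk_on_linear bounded_linear_snd)
  have b: "diffk_on k ?W (\<lambda>z. 1 / (2 * fst (snd (fst z))))"
    by (intro diffk_on_divide diffk_on_mult diffk_on_const T) auto
  show "diffk_on k ?W (\<lambda>z. gap_fun xm (fst (fst z)) (1 / (2 * fst (snd (fst z)))) (snd z) - xm / snd (snd (fst z)))"
    by (intro diffk_on_diff diffk_on_divide diffk_on_const l diffk_on_gap_fun diffk_on_gap_int m b d)
       (use xm_pos in auto)
next
  fix p y assume "p \<in> params3" and y: "(0::real) < y"
  then obtain mu T lam where p: "p = (mu, T, lam)" "0 < mu" "mu \<le> xm" "0 < T" unfolding params3_def by auto
  obtain c where "c < 0" "(gap_fun xm mu (1 / (2 * T)) has_real_derivative c) (at y)"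
    using DERIV_gap_fun_D[OF p(2,3) _ y, of "1 / (2 * T)"] p(4) by auto
  then show "\<exists>c<0. ((\<lambda>y. gap_fun xm (fst (fst (p, y))) (1 / (2 * fst (snd (fst (p, y))))) (snd (p, y))
      - xm / snd (snd (fst (p, y)))) has_real_derivative c) (at y)"
    using p(1) DERIV_diff[OF _ DERIV_const] by (intro exI[of _ c]) fastforce
next
  fix p assume "p \<in> params3"
  then obtain mu T lam where p: "p = (mu, T, lam)" "0 < mu" "mu \<le> xm" "0 < lam" "0 < T" "T < Tc mu lam"
    unfolding params3_def by auto
  let ?b = "1 / (2 * T)"
  have b: "?b > 0" using p(5) by simp
  have "gap_fun xm mu ?b 0 > xm / lam" using less_Tc_iff p by blast
  moreover have "isCont (gap_fun xm mu ?b) 0"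
    using continuous_on_gap_fun[of mu ?b UNIV xm] p(2) b by (simp add: continuous_on_eq_continuous_at)
  ultimately have "eventually (\<lambda>D. gap_fun xm mu ?b D > xm / lam) (at_right 0)"
    unfolding isCont_def using order_tendstoD(1)[OF tendsto_within_subset[of _ _ 0 UNIV "{0<..}"]] by blast
  moreover have "eventually (\<lambda>D::real. D > 0) (at_right 0)" by (simp add: eventually_at_right_less)
  ultimately have "eventually (\<lambda>D. D > 0 \<and> gap_fun xm mu ?b D > xm / lam) (at_right 0)"
    by eventually_elim simp
  then show "\<exists>y>0. 0 < gap_fun xm (fst (fst (p, y))) (1 / (2 * fst (snd (fst (p, y))))) (snd (p, y))
      - xm / snd (snd (fst (p, y)))"
    unfolding p(1) using eventually_happens[of _ "at_right (0::real)"] by fastforce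
  have "xm / lam > 0" using xm_pos p(4) by simp
  then obtain D where D: "D > 0" "gap0_fun xm mu D < xm / lam"
    using gap0_fun_large[OF p(2,3)] by blast
  with gap_fun_less_gap0_fun[OF p(2,3) b D(1)]
  show "\<exists>y>0. gap_fun xm (fst (fst (p, y))) (1 / (2 * fst (snd (fst (p, y))))) (snd (p, y))
      - xm / snd (snd (fst (p, y))) < 0"
    unfolding p(1) by (intro exI[of _ D]) auto
qed

text \<open>From \<open>Tc\<close> on the value 0 is the only nonnegative solution. Fixing it there
  lets the comparison with \<open>Gap0\<close> hold for all \<open>T > 0\<close>.\<close>

definition Gap :: "real \<Rightarrow> real \<Rightarrow> real \<Rightarrow> real" where
  "Gap mu T lam = (if T < Tc mu lam then Gap.root (mu, T, lam) else 0)"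

definition Gap0 :: "real \<Rightarrow> real \<Rightarrow> real" where "Gap0 mu lam = Gap0.root (mu, lam)"

lemma params3I: "0 < mu \<Longrightarrow> mu \<le> xm \<Longrightarrow> 0 < lam \<Longrightarrow> 0 < T \<Longrightarrow> T < Tc mu lam \<Longrightarrow> (mu, T, lam) \<in> params3"
  unfolding params3_def by simp

lemma Gap_pos:
  "0 < mu \<Longrightarrow> mu \<le> xm \<Longrightarrow> 0 < lam \<Longrightarrow> 0 < T \<Longrightarrow> T < Tc mu lam \<Longrightarrow> Gap mu T lam > 0"
  unfolding Gap_def using Gap.root_pos[OF params3I, of mu lam T] by simp

lemma gap_fun_Gap:
  "0 < mu \<Longrightarrow> mu \<le> xm \<Longrightarrow> 0 < lam \<Longrightarrow> 0 < T \<Longrightarrow> T < Tc mu lam \<Longrightarrow>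
    gap_fun xm mu (1 / (2 * T)) (Gap mu T lam) = xm / lam"
  unfolding Gap_def using Gap.root_zero[OF params3I, of mu lam T] by simp

lemma Gap_unique:
  "0 < mu \<Longrightarrow> mu \<le> xm \<Longrightarrow> 0 < lam \<Longrightarrow> 0 < T \<Longrightarrow> T < Tc mu lam \<Longrightarrow> D > 0 \<Longrightarrow>
    gap_fun xm mu (1 / (2 * T)) D = xm / lam \<Longrightarrow> D = Gap mu T lam"
  unfolding Gap_def using Gap.root_unique[OF params3I, of mu lam T D] by simp

lemma less_Gap_iff:
  "0 < mu \<Longrightarrow> mu \<le> xm \<Longrightarrow> 0 < lam \<Longrightarrow> 0 < T \<Longrightarrow> T < Tc mu lam \<Longrightarrow> D > 0 \<Longrightarrow>
    D < Gap mu T lam \<longleftrightarrow> gap_fun xm mu (1 / (2 * T)) D > xm / lam"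
  unfolding Gap_def using Gap.less_root_iff[OF params3I, of mu lam T D] by simp

lemma Gap_less_iff:
  "0 < mu \<Longrightarrow> mu \<le> xm \<Longrightarrow> 0 < lam \<Longrightarrow> 0 < T \<Longrightarrow> T < Tc mu lam \<Longrightarrow> D > 0 \<Longrightarrow>
    Gap mu T lam < D \<longleftrightarrow> gap_fun xm mu (1 / (2 * T)) D < xm / lam"
  unfolding Gap_def using Gap.root_less_iff[OF params3I, of mu lam T D] by simp

lemma Gap_nonneg: "0 < mu \<Longrightarrow> mu \<le> xm \<Longrightarrow> 0 < lam \<Longrightarrow> 0 < T \<Longrightarrow> Gap mu T lam \<ge> 0"
  using Gap_pos[of mu lam T] by (cases "T < Tc mu lam") (auto simp: Gap_def)

lemma Gap0_pos: "0 < mu \<Longrightarrow> mu \<le> xm \<Longrightarrow> 0 < lam \<Longrightarrow> Gap0 mu lam > 0"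
  unfolding Gap0_def by (intro Gap0.root_pos paramsI)

lemma gap0_fun_Gap0:
  "0 < mu \<Longrightarrow> mu \<le> xm \<Longrightarrow> 0 < lam \<Longrightarrow> gap0_fun xm mu (Gap0 mu lam) = xm / lam"
  using Gap0.root_zero[OF paramsI, of mu lam] unfolding Gap0_def by simp

lemma Gap0_unique:
  "0 < mu \<Longrightarrow> mu \<le> xm \<Longrightarrow> 0 < lam \<Longrightarrow> 0 < D \<Longrightarrow> gap0_fun xm mu D = xm / lam \<Longrightarrow> D = Gap0 mu lam"
  using Gap0.root_unique[OF paramsI, of mu lam D] unfolding Gap0_def by simp

lemma less_Gap0_iff:
  "0 < mu \<Longrightarrow> mu \<le> xm \<Longrightarrow> 0 < lam \<Longrightarrow> D > 0 \<Longrightarrow> D < Gap0 mu lam \<longleftrightarrow> gap0_fun xm mu D > xm / lam"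
  using Gap0.less_root_iff[OF paramsI, of mu lam D] unfolding Gap0_def by simp

lemma Gap0_less_iff:
  "0 < mu \<Longrightarrow> mu \<le> xm \<Longrightarrow> 0 < lam \<Longrightarrow> D > 0 \<Longrightarrow> Gap0 mu lam < D \<longleftrightarrow> gap0_fun xm mu D < xm / lam"
  using Gap0.root_less_iff[OF paramsI, of mu lam D] unfolding Gap0_def by simp

text \<open>At \<open>T \<ge> Tc\<close> the gap function at \<open>D = 0\<close> is at most
  \<open>xm / lam\<close>, and at any \<open>D > 0\<close> it is strictly smaller than at 0.\<close>

lemma gap_eq_above_Tc:
  assumes "0 < mu" "mu \<le> xm" "0 < lam" "T \<ge> Tc mu lam" "D \<ge> 0" "gap_eq xm mu lam T D"
  shows "D = 0"
proof (rule ccontr)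
  assume "D \<noteq> 0"
  have T: "T > 0" using Tc_pos[OF assms(1-3)] assms(4) by simp
  have "gap_fun xm mu (1 / (2 * T)) D = xm / lam"
    using assms(6) \<open>D \<noteq> 0\<close> gap_eq_iff[OF T] by simp
  moreover have "gap_fun xm mu (1 / (2 * T)) D < gap_fun xm mu (1 / (2 * T)) 0"
    using assms T \<open>D \<noteq> 0\<close> by (intro gap_fun_less_gap_fun_0) auto
  ultimately show False using less_Tc_iff[OF assms(1-3) T] assms(4) by simp
qed

lemma smooth_on_Tc: "smooth_on params (\<lambda>(mu, lam). Tc mu lam)"
  using Tc.smooth_on_root unfolding Tc_def by simp

lemma smooth_on_Gap0: "smooth_on params (\<lambda>(mu, lam). Gap0 mu lam)"
  using Gap0.smooth_on_root unfolding Gap0_def by simp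

lemma smooth_on_Gap: "smooth_on params3 (\<lambda>(mu, T, lam). Gap mu T lam)"
  unfolding smooth_on_def
proof (intro allI diffk_on_imp_Ck_on)
  fix k
  show "diffk_on k params3 (\<lambda>(mu, T, lam). Gap mu T lam)"
    by (rule diffk_on_cong[OF Gap.diffk_on_root]) (auto simp: params3_def Gap_def)
qed

section \<open>Signs of the partial derivatives\<close>

lemma Tc_DERIV_mu:
  assumes "0 < mu" "mu \<le> xm" "0 < lam"
  shows "\<exists>d>0. ((\<lambda>m. Tc m lam) has_real_derivative d) (at mu within {0<..xm})"
proof -
  let ?b = "1 / (2 * Tc mu lam)"
  have b: "?b > 0" using Tc_pos[OF assms] by simp
  have "((\<lambda>m. gap_fun xm m ?b 0 - xm / lam) has_real_derivative gap_int mu ?b 0 - 0) (at mu)"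
    by (intro DERIV_diff DERIV_gap_fun_mu DERIV_const assms b)
  then have "\<exists>c>0. ((\<lambda>m. Tc m lam) has_real_derivative (gap_int mu ?b 0 - 0) * c) (at mu within {0<..xm})"
    using Tc.root_DERIV_along[where \<gamma>="\<lambda>m. (m, lam)" and t=mu and I="{0<..xm}",
        OF _ has_vector_derivative_Pair1] assms
    unfolding Tc_def by (auto simp: params_def image_subset_iff)
  then show ?thesis using gap_int_pos[OF b assms(1), of 0] by (metis diff_zero mult_pos_pos)
qed

lemma Tc_DERIV_lam:
  assumes "0 < mu" "mu \<le> xm" "0 < lam"
  shows "\<exists>d>0. ((\<lambda>l. Tc mu l) has_real_derivative d) (at lam within {0<..})"
proof -
  obtain a where a: "a > 0"
    "((\<lambda>l. gap_fun xm mu (1 / (2 * Tc mu lam)) 0 - xm / l) has_real_derivative a) (at lam)"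
    using DERIV_minus_coupling[OF assms(3)] by blast
  then have "\<exists>c>0. ((\<lambda>l. Tc mu l) has_real_derivative a * c) (at lam within {0<..})"
    using Tc.root_DERIV_along[where \<gamma>="\<lambda>l. (mu, l)" and t=lam and I="{0<..}",
        OF _ has_vector_derivative_Pair2[OF has_vector_derivative_id]] assms
    unfolding Tc_def by (auto simp: params_def image_subset_iff)
  then show ?thesis using a(1) by (metis mult_pos_pos)
qed

lemma Gap0_DERIV_mu:
  assumes "0 < mu" "mu \<le> xm" "0 < lam"
  shows "\<exists>d>0. ((\<lambda>m. Gap0 m lam) has_real_derivative d) (at mu within {0<..xm})"
proof -
  obtain a where a: "a > 0"
    "((\<lambda>m. gap0_fun xm m (Gap0 mu lam)) has_real_derivative a) (at mu)"
    using DERIV_gap0_fun_mu[OF assms(1) Gap0_pos[OF assms]] by blast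
  have "((\<lambda>m. gap0_fun xm m (Gap0 mu lam) - xm / lam) has_real_derivative a - 0) (at mu)"
    by (intro DERIV_diff DERIV_const a)
  then have "\<exists>c>0. ((\<lambda>m. Gap0 m lam) has_real_derivative (a - 0) * c) (at mu within {0<..xm})"
    using Gap0.root_DERIV_along[where \<gamma>="\<lambda>m. (m, lam)" and t=mu and I="{0<..xm}",
        OF _ has_vector_derivative_Pair1] assms
    unfolding Gap0_def by (auto simp: params_def image_subset_iff)
  then show ?thesis using a(1) by (metis diff_zero mult_pos_pos)
qed

lemma Gap0_DERIV_lam:
  assumes "0 < mu" "mu \<le> xm" "0 < lam"
  shows "\<exists>d>0. ((\<lambda>l. Gap0 mu l) has_real_derivative d) (at lam within {0<..})"
proof -
  obtain a where a: "a > 0"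
    "((\<lambda>l. gap0_fun xm mu (Gap0 mu lam) - xm / l) has_real_derivative a) (at lam)"
    using DERIV_minus_coupling[OF assms(3)] by blast
  then have "\<exists>c>0. ((\<lambda>l. Gap0 mu l) has_real_derivative a * c) (at lam within {0<..})"
    using Gap0.root_DERIV_along[where \<gamma>="\<lambda>l. (mu, l)" and t=lam and I="{0<..}",
        OF _ has_vector_derivative_Pair2[OF has_vector_derivative_id]] assms
    unfolding Gap0_def by (auto simp: params_def image_subset_iff)
  then show ?thesis using a(1) by (metis mult_pos_pos)
qed

text \<open>\<open>Gap\<close> agrees with the root on \<open>params3\<close> only, so the
  derivative is taken within a set \<open>I\<close> that the curve maps into
  \<open>params3\<close>.\<close>

lemma Gap_DERIV_along:
  fixes \<gamma> :: "real \<Rightarrow> real \<times> real \<times> real"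
  assumes t: "t \<in> I" and I: "\<gamma> ` I \<subseteq> params3" and \<gamma>: "(\<gamma> has_vector_derivative v) (at t)"
    and a: "((\<lambda>s. gap_fun xm (fst (\<gamma> s)) (1 / (2 * fst (snd (\<gamma> s)))) (Gap (fst (\<gamma> t)) (fst (snd (\<gamma> t))) (snd (snd (\<gamma> t))))
          - xm / snd (snd (\<gamma> s))) has_real_derivative a) (at t)"
  shows "\<exists>c>0. ((\<lambda>s. Gap (fst (\<gamma> s)) (fst (snd (\<gamma> s))) (snd (snd (\<gamma> s)))) has_real_derivative a * c) (at t within I)"
proof -
  have eq: "Gap (fst p) (fst (snd p)) (snd (snd p)) = Gap.root p" if "p \<in> params3" for p
    using that by (auto simp: params3_def Gap_def)
  have p: "\<gamma> s \<in> params3" if "s \<in> I" for s using I that by blast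
  obtain c where c: "c > 0" "((\<lambda>s. Gap.root (\<gamma> s)) has_real_derivative a * c) (at t within I)"
    using Gap.root_DERIV_along[OF p[OF t] \<gamma> I] a eq[OF p[OF t]] by auto
  have "((\<lambda>s. Gap (fst (\<gamma> s)) (fst (snd (\<gamma> s))) (snd (snd (\<gamma> s)))) has_real_derivative a * c) (at t within I)"
    unfolding has_field_derivative_def
    by (rule has_derivative_transform[OF t _ c(2)[unfolded has_field_derivative_def]]) (use eq p in auto)
  with c(1) show ?thesis by blast
qed

lemma Gap_DERIV_mu:
  assumes "0 < mu" "mu \<le> xm" "0 < lam" "0 < T" "T < Tc mu lam"
  shows "\<exists>d>0. ((\<lambda>m. Gap m T lam) has_real_derivative d) (at mu within {m. 0 < m \<and> m \<le> xm \<and> T < Tc m lam})"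
proof -
  let ?b = "1 / (2 * T)"
  have b: "?b > 0" using assms by simp
  have "((\<lambda>m. gap_fun xm m ?b (Gap mu T lam) - xm / lam) has_real_derivative gap_int mu ?b (Gap mu T lam) - 0) (at mu)"
    by (intro DERIV_diff DERIV_gap_fun_mu DERIV_const assms b)
  then have "\<exists>c>0. ((\<lambda>m. Gap m T lam) has_real_derivative (gap_int mu ?b (Gap mu T lam) - 0) * c)
      (at mu within {m. 0 < m \<and> m \<le> xm \<and> T < Tc m lam})"
    using Gap_DERIV_along[where \<gamma>="\<lambda>m. (m, T, lam)" and t=mu and I="{m. 0 < m \<and> m \<le> xm \<and> T < Tc m lam}",
        OF _ _ has_vector_derivative_Pair1] assms by (auto simp: params3_def)
  then show ?thesis using gap_int_pos[OF b assms(1)] by (metis diff_zero mult_pos_pos)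
qed

lemma Gap_DERIV_T:
  assumes "0 < mu" "mu \<le> xm" "0 < lam" "0 < T" "T < Tc mu lam"
  shows "\<exists>d<0. ((\<lambda>t. Gap mu t lam) has_real_derivative d) (at T within {t. 0 < t \<and> t < Tc mu lam})"
proof -
  obtain a where a: "a < 0" "((\<lambda>t. gap_fun xm mu (1 / (2 * t)) (Gap mu T lam)) has_real_derivative a) (at T)"
    using DERIV_gap_fun_T[OF assms(1,2,4)] by blast
  have "((\<lambda>t. gap_fun xm mu (1 / (2 * t)) (Gap mu T lam) - xm / lam) has_real_derivative a - 0) (at T)"
    by (intro DERIV_diff DERIV_const a)
  then have "\<exists>c>0. ((\<lambda>t. Gap mu t lam) has_real_derivative (a - 0) * c) (at T within {t. 0 < t \<and> t < Tc mu lam})"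
    using Gap_DERIV_along[where \<gamma>="\<lambda>t. (mu, t, lam)" and t=T and I="{t. 0 < t \<and> t < Tc mu lam}",
        OF _ _ has_vector_derivative_Pair2[OF has_vector_derivative_Pair1]] assms by (auto simp: params3_def)
  then show ?thesis using a(1) by (metis diff_zero mult_neg_pos)
qed

lemma Gap_DERIV_lam:
  assumes "0 < mu" "mu \<le> xm" "0 < lam" "0 < T" "T < Tc mu lam"
  shows "\<exists>d>0. ((\<lambda>l. Gap mu T l) has_real_derivative d) (at lam within {l. 0 < l \<and> T < Tc mu l})"
proof -
  obtain a where a: "a > 0"
    "((\<lambda>l. gap_fun xm mu (1 / (2 * T)) (Gap mu T lam) - xm / l) has_real_derivative a) (at lam)"
    using DERIV_minus_coupling[OF assms(3)] by blast
  then have "\<exists>c>0. ((\<lambda>l. Gap mu T l) has_real_derivative a * c) (at lam within {l. 0 < l \<and> T < Tc mu l})"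
    using Gap_DERIV_along[where \<gamma>="\<lambda>l. (mu, T, l)" and t=lam and I="{l. 0 < l \<and> T < Tc mu l}",
        OF _ _ has_vector_derivative_Pair2[OF has_vector_derivative_Pair2[OF has_vector_derivative_id]]] assms
    by (auto simp: params3_def)
  then show ?thesis using a(1) by (metis mult_pos_pos)
qed

text \<open>At \<open>Tc\<close> the gap function at a fixed \<open>y > 0\<close> lies strictly
  below its value \<open>xm / lam\<close> at 0. By continuity in \<open>T\<close> it stays below for
  \<open>T\<close> close to \<open>Tc\<close>, which means \<open>Gap mu T lam < y\<close>.\<close>

lemma Gap_tendsto_0:
  assumes "0 < mu" "mu \<le> xm" "0 < lam"
  shows "((\<lambda>T. Gap mu T lam) \<longlongrightarrow> 0) (at_left (Tc mu lam))"
proof -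
  have Tc0: "Tc mu lam > 0" by (rule Tc_pos[OF assms])
  have ev: "eventually (\<lambda>T. T \<in> {0<..<Tc mu lam}) (at_left (Tc mu lam))"
    using eventually_at_left_real[OF Tc0] .
  show ?thesis
  proof (rule order_tendstoI)
    fix y :: real assume "y < 0"
    show "eventually (\<lambda>T. y < Gap mu T lam) (at_left (Tc mu lam))"
      using ev
    proof eventually_elim
      case (elim T)
      then show ?case using Gap_pos[OF assms, of T] \<open>y < 0\<close> by simp
    qed
  next
    fix y :: real assume y: "0 < y"
    have "gap_fun xm mu (1 / (2 * Tc mu lam)) y < xm / lam"
      using gap_fun_less_gap_fun_0[OF assms(1,2) _ y, of "1 / (2 * Tc mu lam)"] gap_fun_Tc[OF assms] Tc0 by simp
    moreover have "isCont (\<lambda>T. gap_fun xm mu (1 / (2 * T)) y) (Tc mu lam)"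
      using DERIV_gap_fun_T[OF assms(1,2) Tc0] DERIV_isCont by blast
    ultimately have "eventually (\<lambda>T. gap_fun xm mu (1 / (2 * T)) y < xm / lam) (at_left (Tc mu lam))"
      unfolding isCont_def
      using order_tendstoD(2)[OF tendsto_within_subset[of _ _ "Tc mu lam" UNIV "{..<Tc mu lam}"]] by blast
    with ev show "eventually (\<lambda>T. Gap mu T lam < y) (at_left (Tc mu lam))"
    proof eventually_elim
      case (elim T)
      then show ?case using Gap_less_iff[OF assms _ _ y] by simp
    qed
  qed
qed

text \<open>At \<open>D = Gap mu T lam\<close> the zero-temperature function exceeds the gap
  function, whose value there is \<open>xm / lam\<close>; hence this \<open>D\<close> lies below
  \<open>Gap0\<close>.\<close>

lemma Gap_less_Gap0:
  assumes "0 < mu" "mu \<le> xm" "0 < lam" "0 < T"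
  shows "Gap mu T lam < Gap0 mu lam"
proof (cases "T < Tc mu lam")
  case True
  note G = Gap_pos[OF assms True] gap_fun_Gap[OF assms True]
  have "gap_fun xm mu (1 / (2 * T)) (Gap mu T lam) < gap0_fun xm mu (Gap mu T lam)"
    using assms G(1) by (intro gap_fun_less_gap0_fun) auto
  then show ?thesis using less_Gap0_iff[OF assms(1-3) G(1)] G(2) by simp
next
  case False
  then show ?thesis using Gap0_pos[OF assms(1-3)] by (simp add: Gap_def)
qed

text \<open>\<open>Gap0\<close> is an upper bound for every \<open>T > 0\<close>, so only the lower
  half needs a limit: convergence of the gap function at one fixed \<open>y\<close> below
  \<open>Gap0\<close>, without uniformity in \<open>y\<close>.\<close>

lemma Gap_tendsto_Gap0:
  assumes "0 < mu" "mu \<le> xm" "0 < lam"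
  shows "((\<lambda>T. Gap mu T lam) \<longlongrightarrow> Gap0 mu lam) (at_right 0)"
proof (rule order_tendstoI)
  have ev: "eventually (\<lambda>T. T \<in> {0<..<Tc mu lam}) (at_right 0)"
    using eventually_at_right_real[OF Tc_pos[OF assms]] .
  {
    fix y assume y: "y < Gap0 mu lam"
    show "eventually (\<lambda>T. y < Gap mu T lam) (at_right 0)"
    proof (cases "y > 0")
      case True
      have "gap0_fun xm mu y > xm / lam" using less_Gap0_iff[OF assms True] y by simp
      from order_tendstoD(1)[OF tendsto_gap_fun[OF assms(1,2) True] this] ev
      show ?thesis
      proof eventually_elim
        case (elim T)
        then show ?case using less_Gap_iff[OF assms _ _ True] by simp
      qed
    next
      case False
      show ?thesis using ev
      proof eventually_elim
        case (elim T)
        then show ?case using Gap_pos[OF assms, of T] False by simp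
      qed
    qed
  next
    fix y assume y: "Gap0 mu lam < y"
    show "eventually (\<lambda>T. Gap mu T lam < y) (at_right 0)" using ev
    proof eventually_elim
      case (elim T)
      then show ?case using Gap_less_Gap0[OF assms, of T] y by simp
    qed
  }
qed

lemma Gap0_xm: "lam > 0 \<Longrightarrow> Gap0 xm lam = xm / sinh (1 / lam)"
  using Gap0_unique[of xm lam "xm / sinh (1 / lam)"] zeroT_eq_mu_xm[of xm lam] xm_pos
  by (simp add: zeroT_eq_iff)

text \<open>Each explicit end point solution is inserted into the equation for \<open>mu\<close>:
  monotonicity in \<open>mu\<close> at fixed \<open>D\<close> decides on which side of
  \<open>Gap0 mu lam\<close> it lies. When the left bound is not positive, the claim is just
  positivity of the gap.\<close>

lemma Gap0_bounds:
  assumes "0 < mu" "mu < xm" "0 < lam"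
  shows "xm / 2 * (lam - 1 / lam) < Gap0 mu lam" "Gap0 mu lam < xm / sinh (1 / lam)"
proof -
  note mu = assms(1) less_imp_le[OF assms(2)] assms(3)
  have p: "Gap0 xm lam > 0" using Gap0_pos[of xm lam] xm_pos assms by simp
  have "gap0_fun xm mu (Gap0 xm lam) < gap0_fun xm xm (Gap0 xm lam)"
    using assms p by (intro gap0_fun_strict_mono) auto
  also have "\<dots> = xm / lam" using gap0_fun_Gap0[of xm lam] xm_pos assms by simp
  finally show "Gap0 mu lam < xm / sinh (1 / lam)"
    using Gap0_less_iff[OF mu p] Gap0_xm[OF assms(3)] by simp
  let ?D = "xm / 2 * (lam - 1 / lam)"
  show "?D < Gap0 mu lam"
  proof (cases "?D > 0")
    case True
    have "lam > 1"
    proof (rule ccontr)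
      assume "\<not> lam > 1"
      then have "lam \<le> 1" "1 \<le> 1 / lam" using assms(3) by auto
      then have "?D \<le> 0" using xm_pos by (intro mult_nonneg_nonpos) auto
      with True show False by simp
    qed
    then have "gap0_fun xm 0 ?D = xm / lam"
      using zeroT_eq_mu_0_iff[OF xm_pos assms(3) True] by (simp add: zeroT_eq_iff)
    moreover have "gap0_fun xm 0 ?D < gap0_fun xm mu ?D"
      using assms True by (intro gap0_fun_strict_mono) auto
    ultimately show ?thesis using less_Gap0_iff[OF mu True] by simp
  next
    case False
    then show ?thesis using Gap0_pos[OF mu] by simp
  qed
qed

end

theorem theorem1:
  fixes xm :: real
  assumes xm_pos: "xm > 0"
  shows "\<exists>(Tc :: real \<Rightarrow> real \<Rightarrow> real) (Gap :: real \<Rightarrow> real \<Rightarrow> real \<Rightarrow> real)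
            (Gap0 :: real \<Rightarrow> real \<Rightarrow> real).
     \<comment> \<open>(i) existence/uniqueness and the critical temperature\<close>
     (\<forall>mu lam. 0 < mu \<and> mu \<le> xm \<and> 0 < lam \<longrightarrow>
        Tc mu lam > 0
      \<and> (\<forall>T. 0 < T \<and> T < Tc mu lam \<longrightarrow>
            Gap mu T lam > 0 \<and> gap_eq xm mu lam T (Gap mu T lam)
          \<and> (\<forall>D. D > 0 \<and> gap_eq xm mu lam T D \<longrightarrow> D = Gap mu T lam))
      \<and> (\<forall>T. T \<ge> Tc mu lam \<longrightarrow>
            Gap mu T lam = 0 \<and> (\<forall>D. D \<ge> 0 \<and> gap_eq xm mu lam T D \<longrightarrow> D = 0)))
   \<and> smooth_on {(mu, T, lam). 0 < mu \<and> mu \<le> xm \<and> 0 < lam \<and> 0 < T \<and> T < Tc mu lam}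
               (\<lambda>(mu, T, lam). Gap mu T lam)
   \<and> smooth_on {(mu, lam). 0 < mu \<and> mu \<le> xm \<and> 0 < lam} (\<lambda>(mu, lam). Tc mu lam)
     \<comment> \<open>(ii) monotonicity of the gap\<close>
   \<and> (\<forall>mu T lam. 0 < mu \<and> mu \<le> xm \<and> 0 < lam \<and> 0 < T \<and> T < Tc mu lam \<longrightarrow>
        (\<exists>d > 0. ((\<lambda>m. Gap m T lam) has_real_derivative d)
                   (at mu within {m. 0 < m \<and> m \<le> xm \<and> T < Tc m lam}))
      \<and> (\<exists>d < 0. ((\<lambda>t. Gap mu t lam) has_real_derivative d)
                   (at T within {t. 0 < t \<and> t < Tc mu lam}))
      \<and> (\<exists>d > 0. ((\<lambda>l. Gap mu T l) has_real_derivative d)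
                   (at lam within {l. 0 < l \<and> T < Tc mu l})))
     \<comment> \<open>(iii) continuity at Tc\<close>
   \<and> (\<forall>mu lam. 0 < mu \<and> mu \<le> xm \<and> 0 < lam \<longrightarrow>
        ((\<lambda>T. Gap mu T lam) \<longlongrightarrow> 0) (at_left (Tc mu lam)))
     \<comment> \<open>(iv) characterisation of Tc\<close>
   \<and> (\<forall>mu lam. 0 < mu \<and> mu \<le> xm \<and> 0 < lam \<longrightarrow>
        Tc_eq xm mu lam (Tc mu lam) \<and> (\<forall>T. T > 0 \<and> Tc_eq xm mu lam T \<longrightarrow> T = Tc mu lam))
     \<comment> \<open>(v) monotonicity of Tc\<close>
   \<and> (\<forall>mu lam. 0 < mu \<and> mu \<le> xm \<and> 0 < lam \<longrightarrow>
        (\<exists>d > 0. ((\<lambda>m. Tc m lam) has_real_derivative d) (at mu within {0<..xm}))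
      \<and> (\<exists>d > 0. ((\<lambda>l. Tc mu l) has_real_derivative d) (at lam within {0<..})))
     \<comment> \<open>(vi) the zero-temperature gap\<close>
   \<and> (\<forall>mu lam. 0 < mu \<and> mu \<le> xm \<and> 0 < lam \<longrightarrow>
        Gap0 mu lam > 0 \<and> zeroT_eq xm mu lam (Gap0 mu lam)
      \<and> (\<forall>D. D > 0 \<and> zeroT_eq xm mu lam D \<longrightarrow> D = Gap0 mu lam)
      \<and> ((\<lambda>T. Gap mu T lam) \<longlongrightarrow> Gap0 mu lam) (at_right 0)
      \<and> (\<forall>T > 0. Gap0 mu lam > Gap mu T lam \<and> Gap mu T lam \<ge> 0)
      \<and> (\<exists>d > 0. ((\<lambda>m. Gap0 m lam) has_real_derivative d) (at mu within {0<..xm}))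
      \<and> (\<exists>d > 0. ((\<lambda>l. Gap0 mu l) has_real_derivative d) (at lam within {0<..})))
   \<and> smooth_on {(mu, lam). 0 < mu \<and> mu \<le> xm \<and> 0 < lam} (\<lambda>(mu, lam). Gap0 mu lam)
   \<and> (\<forall>mu lam. 0 < mu \<and> mu < xm \<and> 0 < lam \<longrightarrow>
        xm / 2 * (lam - 1 / lam) < Gap0 mu lam \<and> Gap0 mu lam < xm / sinh (1 / lam))
   \<and> (\<forall>lam > 0. Gap0 xm lam = xm / sinh (1 / lam))
   \<and> (\<forall>lam > 0. \<forall>D > 0. zeroT_eq xm 0 lam D \<longleftrightarrow> (lam > 1 \<and> D = xm / 2 * (lam - 1 / lam)))
     \<comment> \<open>(vii) no positive gap at mu = 0 unless lam > 1\<close>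
   \<and> (\<forall>lam T D. 0 < lam \<and> 0 < T \<and> 0 < D \<and> gap_eq xm 0 lam T D \<longrightarrow> lam > 1)"
proof -
  interpret gap_model xm by standard (rule xm_pos)
  show ?thesis
  proof (rule exI[of _ Tc], rule exI[of _ Gap], rule exI[of _ Gap0], intro conjI)
    show "\<forall>mu lam. 0 < mu \<and> mu \<le> xm \<and> 0 < lam \<longrightarrow>
        Tc mu lam > 0
      \<and> (\<forall>T. 0 < T \<and> T < Tc mu lam \<longrightarrow>
            Gap mu T lam > 0 \<and> gap_eq xm mu lam T (Gap mu T lam)
          \<and> (\<forall>D. D > 0 \<and> gap_eq xm mu lam T D \<longrightarrow> D = Gap mu T lam))
      \<and> (\<forall>T. T \<ge> Tc mu lam \<longrightarrow>
            Gap mu T lam = 0 \<and> (\<forall>D. D \<ge> 0 \<and> gap_eq xm mu lam T D \<longrightarrow> D = 0))"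
    proof (intro allI impI conjI; (elim conjE)?)
      fix mu lam T :: real assume A: "0 < mu" "mu \<le> xm" "0 < lam"
      show "Tc mu lam > 0" by (rule Tc_pos[OF A])
      {
        assume T: "0 < T" "T < Tc mu lam"
        show "Gap mu T lam > 0" by (rule Gap_pos[OF A T])
        show "gap_eq xm mu lam T (Gap mu T lam)"
          unfolding gap_eq_iff[OF T(1)] using gap_fun_Gap[OF A T] by blast
        fix D :: real assume "D > 0" "gap_eq xm mu lam T D"
        then show "D = Gap mu T lam"
          using Gap_unique[OF A T] unfolding gap_eq_iff[OF T(1)] by blast
      next
        assume T: "Tc mu lam \<le> T"
        then show "Gap mu T lam = 0" by (simp add: Gap_def)
        fix D :: real assume "D \<ge> 0" "gap_eq xm mu lam T D"
        then show "D = 0" by (rule gap_eq_above_Tc[OF A T])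
      }
    qed
    show "smooth_on {(mu, T, lam). 0 < mu \<and> mu \<le> xm \<and> 0 < lam \<and> 0 < T \<and> T < Tc mu lam}
        (\<lambda>(mu, T, lam). Gap mu T lam)"
      using smooth_on_Gap unfolding params3_def .
    show "smooth_on {(mu, lam). 0 < mu \<and> mu \<le> xm \<and> 0 < lam} (\<lambda>(mu, lam). Tc mu lam)"
      using smooth_on_Tc unfolding params_def .
    show "smooth_on {(mu, lam). 0 < mu \<and> mu \<le> xm \<and> 0 < lam} (\<lambda>(mu, lam). Gap0 mu lam)"
      using smooth_on_Gap0 unfolding params_def .
    show "\<forall>mu lam. 0 < mu \<and> mu \<le> xm \<and> 0 < lam \<longrightarrow>
        Tc_eq xm mu lam (Tc mu lam) \<and> (\<forall>T. T > 0 \<and> Tc_eq xm mu lam T \<longrightarrow> T = Tc mu lam)"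
      using Tc_pos Tc_eq_iff[OF _ _ xm_pos] gap_fun_Tc Tc_unique by blast
    show "\<forall>mu lam. 0 < mu \<and> mu \<le> xm \<and> 0 < lam \<longrightarrow>
        Gap0 mu lam > 0 \<and> zeroT_eq xm mu lam (Gap0 mu lam)
      \<and> (\<forall>D. D > 0 \<and> zeroT_eq xm mu lam D \<longrightarrow> D = Gap0 mu lam)
      \<and> ((\<lambda>T. Gap mu T lam) \<longlongrightarrow> Gap0 mu lam) (at_right 0)
      \<and> (\<forall>T > 0. Gap0 mu lam > Gap mu T lam \<and> Gap mu T lam \<ge> 0)
      \<and> (\<exists>d > 0. ((\<lambda>m. Gap0 m lam) has_real_derivative d) (at mu within {0<..xm}))
      \<and> (\<exists>d > 0. ((\<lambda>l. Gap0 mu l) has_real_derivative d) (at lam within {0<..}))"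
    proof (intro allI impI, elim conjE)
      fix mu lam :: real assume A: "0 < mu" "mu \<le> xm" "0 < lam"
      show "Gap0 mu lam > 0 \<and> zeroT_eq xm mu lam (Gap0 mu lam)
      \<and> (\<forall>D. D > 0 \<and> zeroT_eq xm mu lam D \<longrightarrow> D = Gap0 mu lam)
      \<and> ((\<lambda>T. Gap mu T lam) \<longlongrightarrow> Gap0 mu lam) (at_right 0)
      \<and> (\<forall>T > 0. Gap0 mu lam > Gap mu T lam \<and> Gap mu T lam \<ge> 0)
      \<and> (\<exists>d > 0. ((\<lambda>m. Gap0 m lam) has_real_derivative d) (at mu within {0<..xm}))
      \<and> (\<exists>d > 0. ((\<lambda>l. Gap0 mu l) has_real_derivative d) (at lam within {0<..}))"
        using Gap0_unique[OF A] Gap_less_Gap0[OF A] Gap_nonneg[OF A]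
        by (intro conjI Gap0_pos[OF A] Gap_tendsto_Gap0[OF A] Gap0_DERIV_mu[OF A] Gap0_DERIV_lam[OF A])
           (auto simp: zeroT_eq_iff gap0_fun_Gap0[OF A])
    qed
    show "\<forall>mu T lam. 0 < mu \<and> mu \<le> xm \<and> 0 < lam \<and> 0 < T \<and> T < Tc mu lam \<longrightarrow>
        (\<exists>d > 0. ((\<lambda>m. Gap m T lam) has_real_derivative d)
                   (at mu within {m. 0 < m \<and> m \<le> xm \<and> T < Tc m lam}))
      \<and> (\<exists>d < 0. ((\<lambda>t. Gap mu t lam) has_real_derivative d)
                   (at T within {t. 0 < t \<and> t < Tc mu lam}))
      \<and> (\<exists>d > 0. ((\<lambda>l. Gap mu T l) has_real_derivative d)
                   (at lam within {l. 0 < l \<and> T < Tc mu l}))"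
      by (intro allI impI conjI Gap_DERIV_mu Gap_DERIV_T Gap_DERIV_lam; simp)
    show "\<forall>mu lam. 0 < mu \<and> mu \<le> xm \<and> 0 < lam \<longrightarrow>
        ((\<lambda>T. Gap mu T lam) \<longlongrightarrow> 0) (at_left (Tc mu lam))"
      using Gap_tendsto_0 by simp
    show "\<forall>mu lam. 0 < mu \<and> mu \<le> xm \<and> 0 < lam \<longrightarrow>
        (\<exists>d > 0. ((\<lambda>m. Tc m lam) has_real_derivative d) (at mu within {0<..xm}))
      \<and> (\<exists>d > 0. ((\<lambda>l. Tc mu l) has_real_derivative d) (at lam within {0<..}))"
      by (intro allI impI conjI Tc_DERIV_mu Tc_DERIV_lam; simp)
    show "\<forall>mu lam. 0 < mu \<and> mu < xm \<and> 0 < lam \<longrightarrow>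
        xm / 2 * (lam - 1 / lam) < Gap0 mu lam \<and> Gap0 mu lam < xm / sinh (1 / lam)"
      using Gap0_bounds by blast
    show "\<forall>lam > 0. Gap0 xm lam = xm / sinh (1 / lam)"
      using Gap0_xm by blast
    show "\<forall>lam > 0. \<forall>D > 0. zeroT_eq xm 0 lam D \<longleftrightarrow> (lam > 1 \<and> D = xm / 2 * (lam - 1 / lam))"
      using zeroT_eq_mu_0_iff[OF xm_pos] by blast
    show "\<forall>lam T D. 0 < lam \<and> 0 < T \<and> 0 < D \<and> gap_eq xm 0 lam T D \<longrightarrow> lam > 1"
      using gap_eq_mu_0[OF xm_pos] by blast
  qed
qed

end
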